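(* Let $K\ge 1$, let $A_i\in\mathbb{R}^{m\times n_i}$ for $i=1,\dots,K$, and let $M_K=[A_1\;A_2\;\cdots\;A_K]\in\mathbb{R}^{m\times(n_1+\cdots+n_K)}$, so that $\|M_K\|_F^2=\sum_{i=1}^K\|A_i\|_F^2$. Let $\widetilde\sigma_1(M_K)\ge\widetilde\sigma_2(M_K)\ge\cdots\ge 0$ be the approximate singular values produced by the incremental scheme (described in the context) applied to $A_1,\dots,A_K$. For any integer $r\ge 0$ let $$\mathcal{E}_r(M_K):=\min_{\operatorname{rank}(X)\le r}\|M_K-X\|_F=\Big(\sum_{j>r}\sigma_j^2(M_K)\Big)^{1/2}$$ and define the plug-in estimator $$\widetilde{\mathcal{E}}_r(M_K):=\Big(\sum_{i=1}^K\|A_i\|_F^2-\sum_{j=1}^r\widetilde\sigma_j^2(M_K)\Big)^{1/2}.$$ If the incremental scheme is executed without any truncation, then $\widetilde\sigma_j(M_K)=\sigma_j(M_K)$ for all $j$, and for every $r\ge 0$ $$\widetilde{\mathcal{E}}_r(M_K)=\mathcal{E}_r(M_K).$$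
   Context: For a real matrix $X$, $\sigma_1(X)\ge\sigma_2(X)\ge\cdots\ge 0$ denote its singular values in non-increasing order, extended by zeros beyond the smaller dimension of $X$; $\|\cdot\|_F$ is the Frobenius norm. The minimum defining $\mathcal{E}_r$ is over all real matrices $X$ of the same size as $M_K$ with rank at most $r$. Incremental scheme. The state after $t$ blocks is a pair $(Q_t,S_t)$, where $Q_t\in\mathbb{R}^{m\times r_t}$ has orthonormal columns and $S_t\in\mathbb{R}^{r_t\times r_t}$ is symmetric positive semidefinite. Initially $t=0$, $r_0=0$, and $Q_0,S_0$ are empty. Given the next block $A_{t+1}$, put $Y:=Q_t^\top A_{t+1}$ and $R:=A_{t+1}-Q_tY$. Write $R=Q_{\mathrm{res}}B$ (thin QR decomposition), where $Q_{\mathrm{res}}$ has orthonormal columns that form a basis of the column space of $R$. Then set $$Q_{t+1}:=\begin{bmatrix}Q_t & Q_{\mathrm{res}}\end{bmatrix},\qquad S_{t+1}:=\begin{bmatrix}S_t+YY^\top & YB^\top\\ BY^\top & BB^\top\end{bmatrix}.$$ In the truncated version of the scheme, after each such update one takes an eigendecomposition $S_{t+1}=U\Lambda U^\top$ with eigenvalues in non-increasing order, keeps only the leading $r$ eigenpairs $(U_r,\Lambda_r)$, and replaces $(Q_{t+1},S_{t+1})$ by $(Q_{t+1}U_r,\Lambda_r)$; "executed without any truncation" means that this replacement step is never performed. The approximate singular values are $\widetilde\sigma_j(M_K):=\sqrt{\lambda_j(S_K)}$, where $\lambda_1(S_K)\ge\lambda_2(S_K)\ge\cdots\ge 0$ are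 the eigenvalues of the final (retained) matrix $S_K$, extended by zeros. *)

theory Defs
  imports
    Complex_Main
    "HOL-Computational_Algebra.Polynomial"
    "HOL-Library.Multiset"
    "Jordan_Normal_Form.Char_Poly"
    "Jordan_Normal_Form.DL_Rank"
begin

definition frob_norm :: "real mat \<Rightarrow> real" where
  "frob_norm X = sqrt (\<Sum>i<dim_row X. \<Sum>j<dim_col X. (X $$ (i, j))\<^sup>2)"

text \<open>Real eigenvalues, repeated by algebraic multiplicity, in non-increasing order. Applied below
  to symmetric matrices only, where this is the full spectrum.\<close>

definition eigvals_desc :: "real mat \<Rightarrow> real list" where
  "eigvals_desc S = rev (sorted_list_of_multiset (proots (char_poly S)))"

text \<open>Indices of eigenvalues and singular values start at 1; index 0 has no meaning.\<close>

definition eigval :: "real mat \<Rightarrow> nat \<Rightarrow> real" where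
  "eigval S j = (if 1 \<le> j \<and> j \<le> length (eigvals_desc S) then eigvals_desc S ! (j - 1) else 0)"

definition singval :: "real mat \<Rightarrow> nat \<Rightarrow> real" where
  "singval X j = sqrt (eigval (transpose_mat X * X) j)"

text \<open>The minimum of the Frobenius distances from \<open>M\<close> to the matrices of rank at most \<open>r\<close>.\<close>

definition best_rank_error :: "nat \<Rightarrow> real mat \<Rightarrow> real" where
  "best_rank_error r M = (LEAST e. \<exists>X \<in> carrier_mat (dim_row M) (dim_col M).
     vec_space.rank (dim_row M) X \<le> r \<and> e = frob_norm (M - X))"

definition hcat :: "'a mat \<Rightarrow> 'a mat \<Rightarrow> 'a mat" where
  "hcat P Q = mat_of_cols (dim_row P) (cols P @ cols Q)"

definition block_row :: "nat \<Rightarrow> (nat \<Rightarrow> 'a mat) \<Rightarrow> nat \<Rightarrow> 'a mat" where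
  "block_row m A K = mat_of_cols m (concat (map (\<lambda>i. cols (A i)) [1..<Suc K]))"

definition orthonormal_cols :: "real mat \<Rightarrow> bool" where
  "orthonormal_cols Q \<longleftrightarrow> transpose_mat Q * Q = 1\<^sub>m (dim_col Q)"

definition (in vec_space) is_col_space_basis :: "'a mat \<Rightarrow> 'a vec set \<Rightarrow> bool" where
  "is_col_space_basis R U \<longleftrightarrow> vectorspace.basis class_ring (span_vs (set (cols R))) U"

text \<open>The factor \<open>B\<close> is not required to be triangular, so rank-deficient \<open>R\<close> and pivoted
  factorizations are covered.\<close>

definition thin_qr :: "real mat \<Rightarrow> real mat \<Rightarrow> real mat \<Rightarrow> bool" where
  "thin_qr R Q B \<longleftrightarrow>
     Q \<in> carrier_mat (dim_row R) (dim_col Q) \<and>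
     B \<in> carrier_mat (dim_col Q) (dim_col R) \<and>
     orthonormal_cols Q \<and>
     vec_space.is_col_space_basis (dim_row R) R (set (cols Q)) \<and>
     R = Q * B"

definition block_update ::
    "real mat \<Rightarrow> real mat \<Rightarrow> real mat \<Rightarrow> real mat \<Rightarrow> real mat \<Rightarrow> bool" where
  "block_update Q S A Q' S' \<longleftrightarrow>
     (let Y = transpose_mat Q * A; R = A - Q * Y in
      \<exists>Qres B. thin_qr R Qres B \<and>
        Q' = hcat Q Qres \<and>
        S' = four_block_mat
               (S + Y * transpose_mat Y) (Y * transpose_mat B)
               (B * transpose_mat Y)     (B * transpose_mat B))"

text \<open>Keep the leading \<open>r\<close> eigenpairs, or all of them if there are fewer than \<open>r\<close>.\<close>

definition eig_truncation ::
    "nat \<Rightarrow> real mat \<Rightarrow> real mat \<Rightarrow> real mat \<Rightarrow> real mat \<Rightarrow> bool" where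
  "eig_truncation r Q S Q' S' \<longleftrightarrow>
     (\<exists>U l. U \<in> carrier_mat (dim_row S) (dim_row S) \<and>
        orthonormal_cols U \<and>
        (\<forall>i j. i \<le> j \<and> j < dim_row S \<longrightarrow> l j \<le> l i) \<and>
        S = U * mat_diag (dim_row S) l * transpose_mat U \<and>
        Q' = Q * mat_of_cols (dim_row S) (take r (cols U)) \<and>
        S' = mat_diag (min r (dim_row S)) l)"

text \<open>\<open>incr_state m tr A t Q S\<close>: the pair \<open>(Q, S)\<close> is a possible state after the blocks
  \<open>A 1, \<dots>, A t\<close>. The mode \<open>tr\<close> is \<open>None\<close> for a run without truncation and \<open>Some r\<close> for a run
  truncated to \<open>r\<close> eigenpairs after every update. A relation is used because the QR and
  eigendecompositions are not unique.\<close>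

inductive incr_state ::
    "nat \<Rightarrow> nat option \<Rightarrow> (nat \<Rightarrow> real mat) \<Rightarrow> nat \<Rightarrow> real mat \<Rightarrow> real mat \<Rightarrow> bool"
  for m :: nat and tr :: "nat option" and A :: "nat \<Rightarrow> real mat" where
  init: "incr_state m tr A 0 (0\<^sub>m m 0) (0\<^sub>m 0 0)"
| step: "\<lbrakk>incr_state m tr A t Q S;
          block_update Q S (A (Suc t)) Q1 S1;
          case tr of None \<Rightarrow> Q' = Q1 \<and> S' = S1 | Some r \<Rightarrow> eig_truncation r Q1 S1 Q' S'\<rbrakk>
         \<Longrightarrow> incr_state m tr A (Suc t) Q' S'"

definition approx_singval :: "real mat \<Rightarrow> nat \<Rightarrow> real" where
  "approx_singval S j = sqrt (eigval S j)"

definition plugin_error :: "(nat \<Rightarrow> real mat) \<Rightarrow> nat \<Rightarrow> real mat \<Rightarrow> nat \<Rightarrow> real" where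
  "plugin_error A K S r =
     sqrt ((\<Sum>i = 1..K. (frob_norm (A i))\<^sup>2) - (\<Sum>j = 1..r. (approx_singval S j)\<^sup>2))"

end

theory Submission
  imports Defs "Jordan_Normal_Form.Gram_Schmidt"
begin

text \<open>
  Without truncation the scheme maintains \<open>Q\<^sup>T Q = I\<close> and \<open>Q S Q\<^sup>T = M M\<^sup>T\<close>, where \<open>M\<close> is the
  matrix of the blocks seen so far. Since \<open>x\<^sup>n \<chi>(A B) = x\<^sup>m \<chi>(B A)\<close> for \<open>A\<close> of size \<open>m \<times> n\<close> and \<open>B\<close> of
  size \<open>n \<times> m\<close>, the matrices \<open>S\<close>, \<open>M M\<^sup>T\<close> and \<open>M\<^sup>T M\<close> have the same eigenvalues up to
  zeros. The error formula is the Eckart--Young theorem: if \<open>W\<close> has orthonormal columns spanning the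
  column space of \<open>X\<close>, then \<open>\<parallel>M - X\<parallel>\<^sup>2 \<ge> \<parallel>M\<parallel>\<^sup>2 - \<parallel>W\<^sup>T M\<parallel>\<^sup>2\<close>, and \<open>\<parallel>W\<^sup>T M\<parallel>\<^sup>2\<close> is a combination of the
  eigenvalues of \<open>M M\<^sup>T\<close> with weights in \<open>[0, 1]\<close> that sum up to the rank of \<open>X\<close>.
\<close>

subsection \<open>Characteristic polynomials and spectra of products\<close>

text \<open>With dimension equations as premises no intermediate dimension has to be guessed, so
  rewriting can reassociate long products.\<close>

lemma mult_assoc_dim:
  fixes A B C :: "'a :: semiring_0 mat"
  shows "dim_col A = dim_row B \<Longrightarrow> dim_col B = dim_row C \<Longrightarrow> A * B * C = A * (B * C)"
  by (rule assoc_mult_mat) auto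

lemma transpose_mult_dim:
  fixes A B :: "'a :: comm_semiring_0 mat"
  shows "dim_col A = dim_row B \<Longrightarrow> (A * B)\<^sup>T = B\<^sup>T * A\<^sup>T"
  by (rule transpose_mult) auto

text \<open>The determinant of the block matrix \<open>M\<close> is computed twice by clearing its
  lower left block \<open>b\<close>: multiplying by \<open>L\<close> on the right leaves the Schur
  complement xI - AB, multiplying by \<open>R\<close> on the left leaves xI - BA. The corner xI of
  \<open>R\<close> replaces a division by x; its determinant is the factor of degree
  \<open>n\<close>.\<close>

lemma char_poly_mult_commute:
  fixes A B :: "'a :: idom mat"
  assumes A: "A \<in> carrier_mat m n" and B: "B \<in> carrier_mat n m"
  shows "[:0, 1:] ^ n * char_poly (A * B) = [:0, 1:] ^ m * char_poly (B * A)"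
proof -
  interpret c: comm_ring_hom "\<lambda>a :: 'a. [:a:]"
    by unfold_locales (auto simp: one_pCons)
  define X :: "'a poly" where "X = [:0, 1:]"
  define a where "a = map_mat (\<lambda>a. [:a:]) A"
  define b where "b = map_mat (\<lambda>a. [:a:]) B"
  have a: "a \<in> carrier_mat m n" and b: "b \<in> carrier_mat n m"
    using A B by (auto simp: a_def b_def)
  have ab: "a * b = map_mat (\<lambda>a. [:a:]) (A * B)" and ba: "b * a = map_mat (\<lambda>a. [:a:]) (B * A)"
    using A B by (auto simp: a_def b_def c.mat_hom_mult)
  have cpm: "char_poly_matrix C = X \<cdot>\<^sub>m 1\<^sub>m k - map_mat (\<lambda>a. [:a:]) C"
    if "C \<in> carrier_mat k k" for C k
    using that by (auto simp: char_poly_matrix_def X_def)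
  define M where "M = four_block_mat (X \<cdot>\<^sub>m 1\<^sub>m m) a b (1\<^sub>m n)"
  define L where "L = four_block_mat (1\<^sub>m m) (0\<^sub>m m n) (- b) (1\<^sub>m n)"
  define R where "R = four_block_mat (1\<^sub>m m) (0\<^sub>m m n) (- b) (X \<cdot>\<^sub>m 1\<^sub>m n)"
  have M: "M \<in> carrier_mat (m + n) (m + n)" and L: "L \<in> carrier_mat (m + n) (m + n)"
    and R: "R \<in> carrier_mat (m + n) (m + n)"
    using a b by (auto simp: M_def L_def R_def)
  have "M * L = four_block_mat (char_poly_matrix (A * B)) a (0\<^sub>m n m) (1\<^sub>m n)"
    unfolding M_def L_def
    using A B a b
    by (subst mult_four_block_mat[where ?nr1.0=m and ?nr2.0=n and ?n1.0=m and ?n2.0=n and ?nc1.0=m and ?nc2.0=n])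
      (auto simp: cpm[of _ m] ab[symmetric] intro!: cong_four_block_mat eq_matI)
  hence "det (M * L) = char_poly (A * B)"
    using A B a by (simp add: det_four_block_mat_lower_left_zero[of _ m _ n] char_poly_def)
  moreover have "det L = 1"
    unfolding L_def using b by (subst det_four_block_mat_upper_right_zero[of _ m _ n]) auto
  ultimately have 1: "det M = char_poly (A * B)"
    using det_mult[OF M L] by simp
  have "R * M = four_block_mat (X \<cdot>\<^sub>m 1\<^sub>m m) a (0\<^sub>m n m) (char_poly_matrix (B * A))"
    unfolding M_def R_def
    using A B a b
    by (subst mult_four_block_mat[where ?nr1.0=m and ?nr2.0=n and ?n1.0=m and ?n2.0=n and ?nc1.0=m and ?nc2.0=n])
      (auto simp: cpm[of _ n] ba[symmetric] intro!: cong_four_block_mat eq_matI)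
  hence "det (R * M) = X ^ m * char_poly (B * A)"
    using A B a by (simp add: det_four_block_mat_lower_left_zero[of _ m _ n] char_poly_def)
  moreover have "det R = X ^ n"
    unfolding R_def using b by (subst det_four_block_mat_upper_right_zero[of _ m _ n]) auto
  ultimately show ?thesis
    using det_mult[OF R M] by (simp add: 1 X_def)
qed

text \<open>Zero-based, unlike \<open>eigval\<close>. The default 0 allows spectra of matrices of
  different sizes to be compared.\<close>

definition desc_nth :: "'a :: {linorder, zero} multiset \<Rightarrow> nat \<Rightarrow> 'a" where
  "desc_nth X j = (if j < size X then rev (sorted_list_of_multiset X) ! j else 0)"

text \<open>Among nonnegative elements a new 0 comes last in descending order, exactly where the
  default value is 0 already.\<close>

lemma desc_nth_add_zero:
  assumes "\<And>x. x \<in># X \<Longrightarrow> 0 \<le> x"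
  shows "desc_nth (add_mset 0 X) = desc_nth X"
proof
  fix j
  have "sorted_list_of_multiset (add_mset 0 X) = 0 # sorted_list_of_multiset X"
    using assms by (simp add: insort_is_Cons)
  moreover have "length (sorted_list_of_multiset X) = size X"
    by (metis mset_sorted_list_of_multiset size_mset)
  ultimately show "desc_nth (add_mset 0 X) j = desc_nth X j"
    by (auto simp: desc_nth_def nth_append)
qed

lemma desc_nth_add_zeros:
  assumes "\<And>x. x \<in># X \<Longrightarrow> 0 \<le> x"
  shows "desc_nth (replicate_mset k 0 + X) = desc_nth X"
proof (induction k)
  case (Suc k)
  have "desc_nth (replicate_mset (Suc k) 0 + X) = desc_nth (replicate_mset k 0 + X)"
    using assms by (auto intro!: desc_nth_add_zero simp: in_replicate_mset split: if_splits)
  thus ?case using Suc by simp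
qed simp

lemma eigval_eq_desc_nth: "1 \<le> j \<Longrightarrow> eigval S j = desc_nth (proots (char_poly S)) (j - 1)"
proof -
  have "length (eigvals_desc S) = size (proots (char_poly S))"
    unfolding eigvals_desc_def by (metis length_rev mset_sorted_list_of_multiset size_mset)
  thus "1 \<le> j \<Longrightarrow> ?thesis"
    by (auto simp: eigval_def desc_nth_def eigvals_desc_def)
qed

text \<open>Taking root multisets on both sides turns the powers of x into extra zeros, which
  \<open>desc_nth\<close> ignores. Nonnegativity of the roots for \<open>T\<close> is inherited from
  \<open>S\<close> through this equality.\<close>

lemma eigval_eqI:
  assumes eq: "[:0, 1:] ^ a * char_poly S = [:0, 1:] ^ b * char_poly T"
    and S: "S \<in> carrier_mat p p" and T: "T \<in> carrier_mat q q"
    and nonneg: "\<And>x. x \<in># proots (char_poly S) \<Longrightarrow> 0 \<le> x"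
    and j: "1 \<le> j"
  shows "eigval S j = eigval T j"
proof -
  have "char_poly S \<noteq> 0" "char_poly T \<noteq> 0"
    using degree_monic_char_poly[OF S] degree_monic_char_poly[OF T] by auto
  hence "replicate_mset a 0 + proots (char_poly S) = replicate_mset b 0 + proots (char_poly T)"
    using arg_cong[OF eq, of proots] by (simp add: proots_mult proots_power)
  moreover from this have "\<And>x. x \<in># proots (char_poly T) \<Longrightarrow> 0 \<le> x"
    using nonneg by (metis in_replicate_mset order_refl union_iff)
  ultimately show ?thesis
    using nonneg j by (metis desc_nth_add_zeros eigval_eq_desc_nth)
qed

subsection \<open>The spectral theorem for real symmetric matrices\<close>

text \<open>Supplies the orthogonal change of basis for deflation. A reflection is its own transpose
  and inverse, which avoids completing \<open>v\<close> to an orthonormal basis.\<close>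

lemma householder:
  fixes v :: "real vec"
  assumes v: "v \<in> carrier_vec n" "v \<bullet> v = 1" and n: "0 < n"
  obtains H where "H \<in> carrier_mat n n" "H\<^sup>T = H" "H * H = 1\<^sub>m n" "col H 0 = v"
proof -
  \<comment> \<open>The reflection along \<open>w = v - e\<^sub>0\<close>; if \<open>v = e\<^sub>0\<close> then \<open>c = 1 / 0 = 0\<close> and \<open>H\<close> is the identity.\<close>
  define w where "w i = v $ i - (if i = 0 then 1 else 0)" for i
  define c where "c = 1 / (1 - v $ 0)"
  define H where "H = mat n n (\<lambda>(i, j). (if i = j then 1 else 0) - c * w i * w j)"
  have vv: "(\<Sum>i<n. v $ i * v $ i) = 1"
    using v by (simp add: scalar_prod_def atLeast0LessThan)
  have "(\<Sum>i<n. w i * w i) = (\<Sum>i<n. v $ i * v $ i + (if i = 0 then 1 - 2 * v $ 0 else 0))"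
    by (intro sum.cong) (auto simp: w_def algebra_simps)
  also have "\<dots> = 2 - 2 * v $ 0"
    using n by (simp add: sum.distrib vv)
  finally have ww: "(\<Sum>i<n. w i * w i) = 2 - 2 * v $ 0" .
  \<comment> \<open>Makes the rank-one terms of \<open>H * H\<close> cancel. If
    \<open>v $ 0 \<noteq> 1\<close>, the sum equals \<open>2 / c\<close>; otherwise
    \<open>c = 0\<close>.\<close>
  have c: "c * c * (\<Sum>i<n. w i * w i) = 2 * c"
    by (cases "v $ 0 = 1") (auto simp: ww c_def divide_simps)
  \<comment> \<open>If \<open>v $ 0 \<noteq> 1\<close> then \<open>- c * w 0 = 1\<close>; otherwise
    the squared norm of \<open>w\<close> is 0 and \<open>w\<close> vanishes.\<close>
  have w0: "- c * w 0 * w i = w i" if "i < n" for i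
  proof (cases "v $ 0 = 1")
    case True
    hence "\<forall>i\<in>{..<n}. w i * w i = 0"
      using ww sum_nonneg_eq_0_iff[of "{..<n}" "\<lambda>i. w i * w i"] by simp
    thus ?thesis using that by auto
  qed (auto simp: c_def w_def divide_simps algebra_simps)
  have "H * H = 1\<^sub>m n"
  proof (rule eq_matI)
    fix i j assume "i < dim_row (1\<^sub>m n :: real mat)" "j < dim_col (1\<^sub>m n :: real mat)"
    hence ij: "i < n" "j < n" by auto
    have "(H * H) $$ (i, j)
      = (\<Sum>k<n. ((if i = k then 1 else 0) - c * w i * w k) * ((if k = j then 1 else 0) - c * w k * w j))"
      using ij by (auto simp: H_def scalar_prod_def atLeast0LessThan)
    also have "\<dots> = (\<Sum>k<n. (if k = j then (if i = j then 1 else 0) - c * w i * w k else 0)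
        - (if k = i then c * w k * w j else 0) + w i * w j * (c * c * (w k * w k)))"
      by (intro sum.cong) (auto simp: algebra_simps)
    also have "\<dots> = (if i = j then 1 else 0) - 2 * c * w i * w j
        + w i * w j * (c * c * (\<Sum>k<n. w k * w k))"
      using ij by (simp add: sum.distrib sum_subtractf sum_distrib_left)
    also have "\<dots> = 1\<^sub>m n $$ (i, j)"
      unfolding c using ij by simp
    finally show "(H * H) $$ (i, j) = 1\<^sub>m n $$ (i, j)" .
  qed (auto simp: H_def)
  moreover have "col H 0 = v"
  proof (rule eq_vecI)
    fix i assume "i < dim_vec v"
    hence i: "i < n" using v by simp
    have "c * w i * w 0 = - w i" using w0[OF i] by (simp add: algebra_simps)
    hence "(if i = 0 then 1 else 0) - c * w i * w 0 = v $ i" by (simp add: w_def[of i])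
    thus "col H 0 $ i = v $ i" using i n by (simp add: H_def)
  qed (use v in \<open>simp add: H_def\<close>)
  moreover have "H\<^sup>T = H" by (rule eq_matI) (auto simp: H_def)
  ultimately show thesis using that[of H] by (auto simp: H_def)
qed

lemma smult_unit_vector:
  fixes v :: "real vec"
  assumes v: "v \<in> carrier_vec n" "v \<noteq> 0\<^sub>v n"
  defines "u \<equiv> (1 / sqrt (v \<bullet> v)) \<cdot>\<^sub>v v"
  shows "u \<in> carrier_vec n" "u \<bullet> u = 1"
proof -
  show "u \<in> carrier_vec n" using v by (simp add: u_def)
  have "v \<bullet> v > 0"
    using v conjugate_square_greater_0_vec[of v n] by simp
  thus "u \<bullet> u = 1" using v by (simp add: u_def divide_simps)
qed

text \<open>The polynomial splits over the complex numbers. A root \<open>c\<close> with eigenvector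
  \<open>v\<close> is real because \<open>C\<close> is self-adjoint: \<open>c\<close> and
  \<open>cnj c\<close> give the same multiple of the nonzero number \<open>v \<bullet>c v\<close>.
  The factorization descends to the reals since the embedding of polynomials is injective.\<close>

lemma real_symmetric_char_poly_splits:
  fixes G :: "real mat"
  assumes G: "G \<in> carrier_mat n n" and sym: "G\<^sup>T = G"
  obtains es where "char_poly G = (\<Prod>e\<leftarrow>es. [:- e, 1:])"
proof -
  define C where "C = map_mat complex_of_real G"
  have C: "C \<in> carrier_mat n n" using G by (simp add: C_def)
  obtain cs where cs: "char_poly C = (\<Prod>c\<leftarrow>cs. [:- c, 1:])"
    using char_poly_factorized[OF C] by auto
  have real: "c = complex_of_real (Re c)" if "c \<in> set cs" for c
  proof -
    have "poly (char_poly C) c = 0"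
      using that unfolding cs poly_prod_list by (auto simp: prod_list_zero_iff)
    hence "eigenvalue C c" using eigenvalue_root_char_poly[OF C] by simp
    then obtain v where v: "v \<in> carrier_vec n" "v \<noteq> 0\<^sub>v n" and ev: "C *\<^sub>v v = c \<cdot>\<^sub>v v"
      using C by (auto simp: eigenvalue_def eigenvector_def)
    have Cij: "C $$ (i, j) = C $$ (j, i)" "cnj (C $$ (i, j)) = C $$ (i, j)" if "i < n" "j < n" for i j
      using that G arg_cong[OF sym, of "\<lambda>M. M $$ (i, j)"] by (auto simp: C_def)
    have "c * (v \<bullet>c v) = (C *\<^sub>v v) \<bullet>c v"
      using v by (simp add: ev)
    also have "\<dots> = (\<Sum>i<n. (\<Sum>j<n. C $$ (i, j) * v $ j) * cnj (v $ i))"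
      using C v by (simp add: scalar_prod_def atLeast0LessThan)
    also have "\<dots> = (\<Sum>i<n. \<Sum>j<n. C $$ (j, i) * v $ i * cnj (v $ j))"
      unfolding sum_distrib_right by (rule sum.swap)
    also have "\<dots> = (\<Sum>i<n. v $ i * cnj (\<Sum>j<n. C $$ (i, j) * v $ j))"
      unfolding cnj_sum sum_distrib_left
      by (intro sum.cong refl) (simp, metis Cij lessThan_iff mult.commute mult.left_commute)
    also have "\<dots> = v \<bullet>c (C *\<^sub>v v)"
      using C v by (simp add: scalar_prod_def atLeast0LessThan)
    also have "\<dots> = cnj c * (v \<bullet>c v)"
      using v by (simp add: ev conjugate_smult_vec)
    finally have "c = cnj c"
      using v by simp
    thus ?thesis by (metis Reals_cnj_iff complex_is_Real_iff of_real_Re)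
  qed
  interpret h: map_poly_inj_comm_ring_hom complex_of_real ..
  define es where "es = map Re cs"
  have "map_poly complex_of_real (char_poly G) = char_poly C"
    unfolding C_def by (simp add: of_real_hom.char_poly_hom[OF G])
  also have "\<dots> = (\<Prod>e\<leftarrow>es. [:- complex_of_real e, 1:])"
    unfolding cs es_def using real by (auto intro!: arg_cong[of _ _ prod_list] simp: o_def)
  also have "\<dots> = map_poly complex_of_real (\<Prod>e\<leftarrow>es. [:- e, 1:])"
    by (induction es) (simp_all add: hom_distribs del: mult_pCons_left)
  finally have "char_poly G = (\<Prod>e\<leftarrow>es. [:- e, 1:])"
    by simp
  thus thesis by (rule that)
qed

text \<open>Deflation, by induction on the list of eigenvalues: a reflection moves a unit
  eigenvector for the head to the first axis, and the complementary block is symmetric with the tail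
  as its roots. The list may have any order, and the diagonal follows it.\<close>

lemma spectral_decomposition:
  fixes G :: "real mat"
  assumes "G \<in> carrier_mat n n" "G\<^sup>T = G" "char_poly G = (\<Prod>e\<leftarrow>es. [:- e, 1:])"
  shows "length es = n \<and> (\<exists>U \<in> carrier_mat n n. U\<^sup>T * U = 1\<^sub>m n \<and> G = U * mat_diag n ((!) es) * U\<^sup>T)"
  using assms
proof (induction es arbitrary: n G)
  case Nil
  have "n = 0" using degree_monic_char_poly[OF Nil(1)] Nil(3) by simp
  thus ?case using Nil(1) by (auto intro!: bexI[of _ "1\<^sub>m 0"])
next
  case (Cons e es)
  note G = Cons.prems(1) and sym = Cons.prems(2) and cp = Cons.prems(3)
  have "degree (char_poly G) = Suc (length es)"
    unfolding cp using degree_linear_factors[of uminus "e # es"] by simp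
  then obtain k where n: "n = Suc k" and k: "k = length es"
    using degree_monic_char_poly[OF G] by auto
  have "eigenvalue G e"
    unfolding eigenvalue_root_char_poly[OF G] cp by simp
  then obtain v' where v': "v' \<in> carrier_vec n" "v' \<noteq> 0\<^sub>v n" "G *\<^sub>v v' = e \<cdot>\<^sub>v v'"
    using G by (auto simp: eigenvalue_def eigenvector_def)
  define v where "v = (1 / sqrt (v' \<bullet> v')) \<cdot>\<^sub>v v'"
  have v: "v \<in> carrier_vec n" "v \<bullet> v = 1"
    using smult_unit_vector[OF v'(1,2)] by (simp_all add: v_def)
  have ev: "G *\<^sub>v v = e \<cdot>\<^sub>v v"
    using v' G by (simp add: v_def mult_mat_vec smult_smult_assoc mult.commute)
  obtain H where H: "H \<in> carrier_mat n n" and HT: "H\<^sup>T = H" and HH: "H * H = 1\<^sub>m n"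
    and H0: "col H 0 = v"
    using householder[OF v] n by auto
  \<comment> \<open>\<open>H\<close> exchanges \<open>v\<close> and the first unit vector, so the
    first column of \<open>B\<close> is \<open>e\<close> times that vector; symmetry of
    \<open>B\<close> then clears the first row as well.\<close>
  define B where "B = H * G * H"
  have B: "B \<in> carrier_mat n n" using H G by (simp add: B_def)
  have BT: "B\<^sup>T = B"
    using H G by (simp add: B_def transpose_mult_dim HT sym mult_assoc_dim)
  have Hv: "H *\<^sub>v v = col (1\<^sub>m n) 0"
    using col_mult2[OF H H, of 0] n by (simp add: HH H0)
  have "col B 0 = H *\<^sub>v (G *\<^sub>v col H 0)"
    using H G n col_mult2[OF H, of "G * H" n 0] col_mult2[OF G H, of 0]
    by (simp add: B_def mult_assoc_dim del: col_mult)
  also have "\<dots> = e \<cdot>\<^sub>v col (1\<^sub>m n) 0"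
    using H v by (simp add: H0 ev mult_mat_vec Hv)
  finally have colB: "col B 0 = e \<cdot>\<^sub>v col (1\<^sub>m n) 0" .
  have "B $$ (i, 0) = (if i = 0 then e else 0)" if "i < n" for i
    using that B n arg_cong[OF colB, of "\<lambda>x. x $ i"] by simp
  moreover have "B $$ (0, i) = B $$ (i, 0)" if "i < n" for i
    using that B n arg_cong[OF BT, of "\<lambda>M. M $$ (i, 0)"] by simp
  ultimately have Bi0: "B $$ (i, 0) = (if i = 0 then e else 0)" "B $$ (0, i) = (if i = 0 then e else 0)"
    if "i < n" for i
    using that by auto
  define G' where "G' = mat k k (\<lambda>(i, j). B $$ (Suc i, Suc j))"
  have G': "G' \<in> carrier_mat k k" by (simp add: G'_def)
  have blockB: "B = four_block_mat (mat 1 1 (\<lambda>_. e)) (0\<^sub>m 1 k) (0\<^sub>m k 1) G'"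
    using B by (intro eq_matI) (auto simp: Bi0 G'_def n)
  have G'T: "G'\<^sup>T = G'"
  proof (rule eq_matI)
    fix i j assume "i < dim_row G'" "j < dim_col G'"
    thus "G'\<^sup>T $$ (i, j) = G' $$ (i, j)"
      using arg_cong[OF BT, of "\<lambda>M. M $$ (Suc i, Suc j)"] B n by (simp add: G'_def)
  qed (auto simp: G'_def)
  have cp1: "char_poly (mat 1 1 (\<lambda>_. e)) = [:- e, 1:]"
    by (subst char_poly_upper_triangular[of _ 1]) (auto simp: diag_mat_def upper_triangular_def)
  have "similar_mat B G"
    unfolding similar_mat_def
    using H G B HH by (intro exI[of _ H] similar_mat_witI[of _ _ n]) (auto simp: B_def)
  hence "char_poly G = char_poly B"
    using char_poly_similar by metis
  also have "\<dots> = [:- e, 1:] * char_poly G'"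
    unfolding blockB using G'
    by (subst char_poly_four_block_zeros_col[of _ _ k]) (simp_all only: cp1, auto)
  finally have "[:- e, 1:] * char_poly G' = [:- e, 1:] * (\<Prod>e\<leftarrow>es. [:- e, 1:])"
    unfolding cp by (simp del: mult_pCons_left)
  hence "char_poly G' = (\<Prod>e\<leftarrow>es. [:- e, 1:])"
    unfolding mult_cancel_left by simp
  from Cons.IH[OF G' G'T this] obtain U' where U': "U' \<in> carrier_mat k k"
    and U'o: "U'\<^sup>T * U' = 1\<^sub>m k" and G'eq: "G' = U' * mat_diag k ((!) es) * U'\<^sup>T" by auto
  \<comment> \<open>\<open>W\<close> diagonalizes \<open>B\<close>, and
    \<open>G = H * B * H\<close>, so \<open>H * W\<close> will be the witness for
    \<open>G\<close>.\<close>
  define W where "W = four_block_mat (1\<^sub>m 1) (0\<^sub>m 1 k) (0\<^sub>m k 1) U'"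
  have W: "W \<in> carrier_mat n n" using U' unfolding W_def n by (metis four_block_carrier_mat one_carrier_mat plus_1_eq_Suc)
  have WT: "W\<^sup>T = four_block_mat (1\<^sub>m 1) (0\<^sub>m 1 k) (0\<^sub>m k 1) U'\<^sup>T"
    unfolding W_def using U' by (subst transpose_four_block_mat[of _ 1 1 _ k _ k]) auto
  have "W\<^sup>T * W = four_block_mat (1\<^sub>m 1) (0\<^sub>m 1 k) (0\<^sub>m k 1) (1\<^sub>m k)"
    unfolding WT unfolding W_def using U'
    by (subst mult_four_block_mat[where ?nr1.0 = 1 and ?nr2.0 = k and ?n1.0 = 1 and ?n2.0 = k and ?nc1.0 = 1 and ?nc2.0 = k])
      (auto simp: U'o)
  hence Wo: "W\<^sup>T * W = 1\<^sub>m n" by (simp add: n)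
  have diag: "mat_diag n ((!) (e # es)) =
    four_block_mat (mat 1 1 (\<lambda>_. e)) (0\<^sub>m 1 k) (0\<^sub>m k 1) (mat_diag k ((!) es))"
    by (rule eq_matI) (auto simp: mat_diag_def n nth_Cons')
  have four_mult: "four_block_mat A (0\<^sub>m 1 k) (0\<^sub>m k 1) D * four_block_mat A' (0\<^sub>m 1 k) (0\<^sub>m k 1) D'
      = four_block_mat (A * A') (0\<^sub>m 1 k) (0\<^sub>m k 1) (D * D')"
    if "A \<in> carrier_mat 1 1" "A' \<in> carrier_mat 1 1" "D \<in> carrier_mat k k" "D' \<in> carrier_mat k k"
    for A A' D D' :: "real mat"
    using that
    by (subst mult_four_block_mat[where ?nr1.0 = 1 and ?nr2.0 = k and ?n1.0 = 1 and ?n2.0 = k and ?nc1.0 = 1 and ?nc2.0 = k]) auto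
  have "W * mat_diag n ((!) (e # es)) * W\<^sup>T = B"
    unfolding diag WT blockB unfolding W_def using U'
    by (simp add: four_mult G'eq mult_carrier_mat[of _ k k _ k] del: One_nat_def)
  hence WB: "W * (mat_diag n ((!) (e # es)) * W\<^sup>T) = B"
    using W by (simp add: mult_assoc_dim mat_diag_def)
  have HHx: "H * (H * X) = X" if "X \<in> carrier_mat n l" for X l
    using that H HH by (metis assoc_mult_mat left_mult_one_mat)
  have "(H * W)\<^sup>T * (H * W) = W\<^sup>T * (H * (H * W))"
    using H W by (simp add: transpose_mult_dim mult_assoc_dim HT)
  moreover have "H * W * mat_diag n ((!) (e # es)) * (H * W)\<^sup>T = H * (W * (mat_diag n ((!) (e # es)) * W\<^sup>T)) * H"
    using H W by (simp add: transpose_mult_dim mult_assoc_dim HT mat_diag_def)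
  moreover have "H * B * H = G"
    using H G by (simp add: B_def mult_assoc_dim HHx[of _ n] HH)
  ultimately show ?case
    using H W Wo WB n k by (intro conjI bexI[of _ "H * W"]) (auto simp: HHx[of _ n])
qed

lemma real_symmetric_spectral:
  fixes G :: "real mat"
  assumes G: "G \<in> carrier_mat n n" and sym: "G\<^sup>T = G"
  obtains U where "U \<in> carrier_mat n n" "U\<^sup>T * U = 1\<^sub>m n"
    "G = U * mat_diag n ((!) (eigvals_desc G)) * U\<^sup>T"
    "length (eigvals_desc G) = n" "mset (eigvals_desc G) = proots (char_poly G)"
proof -
  obtain es where es: "char_poly G = (\<Prod>e\<leftarrow>es. [:- e, 1:])"
    by (rule real_symmetric_char_poly_splits[OF G sym])
  have "(\<Prod>e\<leftarrow>es. [:- e, 1:]) \<noteq> 0" for es :: "real list"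
    by (auto simp: prod_list_zero_iff)
  hence "proots (\<Prod>e\<leftarrow>es. [:- e, 1:]) = mset es" for es :: "real list"
    by (induction es) (simp_all add: proots_mult del: mult_pCons_left)
  hence pr: "proots (char_poly G) = mset es" by (simp add: es)
  have m: "mset (eigvals_desc G) = mset es"
    by (simp add: eigvals_desc_def pr)
  \<comment> \<open>The product ignores the order of its factors, so the decomposition can be
    requested for the sorted list.\<close>
  have "char_poly G = (\<Prod>e\<leftarrow>eigvals_desc G. [:- e, 1:])"
    unfolding es by (metis m mset_map prod_mset_prod_list)
  from spectral_decomposition[OF G sym this] that show thesis
    using m pr by metis
qed

subsection \<open>Frobenius norm and low-rank approximation\<close>

definition tr :: "'a :: comm_monoid_add mat \<Rightarrow> 'a" where
  "tr A = (\<Sum>i<dim_row A. A $$ (i, i))"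

lemma tr_mult_commute:
  fixes A B :: "'a :: comm_semiring_0 mat"
  assumes "A \<in> carrier_mat m n" "B \<in> carrier_mat n m"
  shows "tr (A * B) = tr (B * A)"
proof -
  have "tr (A * B) = (\<Sum>i<m. \<Sum>j<n. A $$ (i, j) * B $$ (j, i))"
    using assms by (auto simp: tr_def scalar_prod_def atLeast0LessThan)
  also have "\<dots> = tr (B * A)"
    using assms by (subst sum.swap) (auto simp: tr_def scalar_prod_def atLeast0LessThan mult.commute)
  finally show ?thesis .
qed

lemma tr_one [simp]: "tr (1\<^sub>m n :: 'a :: semiring_1 mat) = of_nat n"
  by (simp add: tr_def)

lemma tr_minus:
  fixes A B :: "'a :: ab_group_add mat"
  shows "A \<in> carrier_mat n n \<Longrightarrow> B \<in> carrier_mat n n \<Longrightarrow> tr (A - B) = tr A - tr B"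
  by (auto simp: tr_def sum_subtractf)

lemma frob_norm_sq_eq_tr: "(frob_norm X)\<^sup>2 = tr (X\<^sup>T * X)"
proof -
  have "tr (X\<^sup>T * X) = (\<Sum>j<dim_col X. \<Sum>i<dim_row X. (X $$ (i, j))\<^sup>2)"
    by (auto simp: tr_def scalar_prod_def atLeast0LessThan power2_eq_square)
  also have "\<dots> = (frob_norm X)\<^sup>2"
    unfolding frob_norm_def by (subst sum.swap) (simp add: sum_nonneg)
  finally show ?thesis ..
qed

lemma frob_norm_nonneg: "0 \<le> frob_norm X"
  by (simp add: frob_norm_def sum_nonneg)

text \<open>Pythagoras: the residual \<open>E\<close> is orthogonal to the columns of
  \<open>W\<close>, hence \<open>E\<^sup>T * E = E\<^sup>T * D\<close>, and expanding the left
  factor subtracts the Gram matrix of \<open>W\<^sup>T * D\<close>.\<close>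

lemma frob_norm_sq_minus_proj:
  assumes W: "W \<in> carrier_mat m k" "W\<^sup>T * W = 1\<^sub>m k" and D: "D \<in> carrier_mat m n"
  shows "(frob_norm (D - W * (W\<^sup>T * D)))\<^sup>2 = (frob_norm D)\<^sup>2 - (frob_norm (W\<^sup>T * D))\<^sup>2"
proof -
  define E where "E = D - W * (W\<^sup>T * D)"
  have E: "E \<in> carrier_mat m n"
    unfolding E_def using W(1) D by (intro minus_carrier_mat mult_carrier_mat[of _ m k]) auto
  have "W\<^sup>T * E = W\<^sup>T * D - W\<^sup>T * (W * (W\<^sup>T * D))"
    unfolding E_def using W(1) D by (intro mult_minus_distrib_mat) auto
  also have "W\<^sup>T * (W * (W\<^sup>T * D)) = W\<^sup>T * W * (W\<^sup>T * D)"
    using W(1) D by (simp add: mult_assoc_dim)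
  also have "\<dots> = W\<^sup>T * D" using W D by simp
  finally have WE: "W\<^sup>T * E = 0\<^sub>m k n" using W D by (simp add: minus_r_inv_mat[of _ k n])
  have EW: "E\<^sup>T * W = 0\<^sub>m n k"
    using arg_cong[OF WE, of transpose_mat] W E by (simp add: transpose_mult_dim)
  have "E\<^sup>T * E = E\<^sup>T * D - E\<^sup>T * (W * (W\<^sup>T * D))"
    using W(1) D E by (subst (2) E_def, intro mult_minus_distrib_mat) auto
  also have "E\<^sup>T * (W * (W\<^sup>T * D)) = E\<^sup>T * W * (W\<^sup>T * D)"
    using W(1) D E by (simp add: mult_assoc_dim)
  also have "\<dots> = 0\<^sub>m n n" using EW W D by simp
  finally have "E\<^sup>T * E = E\<^sup>T * D" using D E by auto
  also have "\<dots> = D\<^sup>T * D - (W * (W\<^sup>T * D))\<^sup>T * D"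
    using W(1) D unfolding E_def
    by (subst transpose_minus, auto intro!: minus_mult_distrib_mat)
  also have "(W * (W\<^sup>T * D))\<^sup>T * D = (W\<^sup>T * D)\<^sup>T * (W\<^sup>T * D)"
    using W(1) D by (simp add: transpose_mult_dim mult_assoc_dim)
  finally show ?thesis
    using W(1) D unfolding frob_norm_sq_eq_tr E_def[symmetric] by (subst tr_minus[symmetric, of _ n]) auto
qed

text \<open>For \<open>r < m\<close> take \<open>l r\<close> as threshold:
  \<open>(l i - l r) * c i\<close> is at most \<open>l i - l r\<close> for \<open>i < r\<close> and
  at most 0 beyond, and the total weight adds at most \<open>l r * real r\<close>. For larger
  \<open>r\<close> the bound \<open>c i \<le> 1\<close> suffices.\<close>

lemma sum_weighted_le_sum_leading:
  fixes l c :: "nat \<Rightarrow> real"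
  assumes mono: "\<And>i j. i \<le> j \<Longrightarrow> j < m \<Longrightarrow> l j \<le> l i" and nonneg: "\<And>i. i < m \<Longrightarrow> 0 \<le> l i"
    and c: "\<And>i. i < m \<Longrightarrow> 0 \<le> c i" "\<And>i. i < m \<Longrightarrow> c i \<le> 1" "(\<Sum>i<m. c i) \<le> real r"
  shows "(\<Sum>i<m. l i * c i) \<le> (\<Sum>i<min r m. l i)"
proof (cases "r < m")
  case False
  have "(\<Sum>i<m. l i * c i) \<le> (\<Sum>i<m. l i)"
    using nonneg c by (intro sum_mono mult_left_le) auto
  thus ?thesis using False by simp
next
  case True
  have "(\<Sum>i<m. l i * c i) = (\<Sum>i<m. (l i - l r) * c i) + l r * (\<Sum>i<m. c i)"
    by (simp add: sum_distrib_left sum.distrib[symmetric] algebra_simps)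
  also have "\<dots> \<le> (\<Sum>i<m. if i < r then l i - l r else 0) + l r * real r"
    using True c nonneg mono
    by (intro add_mono sum_mono mult_left_mono)
      (auto intro: mult_left_le mult_nonpos_nonneg)
  also have "(\<Sum>i<m. if i < r then l i - l r else 0) = (\<Sum>i<r. l i - l r)"
    using True by (intro sum.mono_neutral_cong_right) auto
  finally show ?thesis using True by (simp add: sum_subtractf)
qed

text \<open>\<open>Z * Z\<^sup>T\<close> is symmetric and idempotent, so a diagonal entry is the
  squared norm of its row and thus at least its own square.\<close>

lemma diag_proj_le_one:
  fixes Z :: "real mat"
  assumes Z: "Z \<in> carrier_mat m k" "Z\<^sup>T * Z = 1\<^sub>m k" and i: "i < m"
  shows "0 \<le> (Z * Z\<^sup>T) $$ (i, i)" "(Z * Z\<^sup>T) $$ (i, i) \<le> 1"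
proof -
  define P where "P = Z * Z\<^sup>T"
  have P: "P \<in> carrier_mat m m" using Z by (simp add: P_def)
  have PT: "P\<^sup>T = P" using Z by (simp add: P_def transpose_mult_dim)
  have "P * P = Z * (Z\<^sup>T * Z) * Z\<^sup>T" using Z(1) by (simp add: P_def mult_assoc_dim)
  hence PP: "P * P = P" using Z by (simp add: P_def)
  have Pji: "P $$ (j, i) = P $$ (i, j)" if "j < m" for j
    using that P i arg_cong[OF PT, of "\<lambda>M. M $$ (i, j)"] by simp
  have "P $$ (i, i) = (\<Sum>j<m. P $$ (i, j) * P $$ (j, i))"
    using P i arg_cong[OF PP, of "\<lambda>M. M $$ (i, i)"] by (simp add: scalar_prod_def atLeast0LessThan)
  also have "\<dots> = (\<Sum>j<m. (P $$ (i, j))\<^sup>2)"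
    by (intro sum.cong refl) (metis Pji lessThan_iff power2_eq_square)
  finally have "P $$ (i, i) = (\<Sum>j<m. (P $$ (i, j))\<^sup>2)" .
  moreover have "(P $$ (i, i))\<^sup>2 \<le> (\<Sum>j<m. (P $$ (i, j))\<^sup>2)"
    using i by (intro member_le_sum) auto
  ultimately have "(P $$ (i, i))\<^sup>2 \<le> P $$ (i, i)" by simp
  hence "0 \<le> P $$ (i, i)" "P $$ (i, i) \<le> 1"
    using zero_le_power2[of "P $$ (i, i)"] by (linarith, auto simp: power2_eq_square mult_le_cancel_left2 intro: ccontr)
  thus "0 \<le> (Z * Z\<^sup>T) $$ (i, i)" "(Z * Z\<^sup>T) $$ (i, i) \<le> 1"
    by (simp_all add: P_def)
qed

text \<open>Cyclicity of the trace brings \<open>mat_diag m l\<close> next to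
  \<open>Z * Z\<^sup>T\<close>, of which only the diagonal then matters: these entries are the
  weights of the eigenvalues.\<close>

lemma frob_norm_sq_transpose_mult:
  assumes M: "M \<in> carrier_mat m n" and W: "W \<in> carrier_mat m k" and U: "U \<in> carrier_mat m m"
    and eq: "M * M\<^sup>T = U * mat_diag m l * U\<^sup>T"
  shows "(frob_norm (W\<^sup>T * M))\<^sup>2 = (\<Sum>i<m. l i * ((U\<^sup>T * W) * (U\<^sup>T * W)\<^sup>T) $$ (i, i))"
proof -
  define Z where "Z = U\<^sup>T * W"
  have Z: "Z \<in> carrier_mat m k" using U W by (simp add: Z_def)
  have "(frob_norm (W\<^sup>T * M))\<^sup>2 = tr ((W\<^sup>T * M) * (W\<^sup>T * M)\<^sup>T)"
    unfolding frob_norm_sq_eq_tr using M W by (intro tr_mult_commute[of _ n k]) auto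
  also have "(W\<^sup>T * M) * (W\<^sup>T * M)\<^sup>T = W\<^sup>T * ((M * M\<^sup>T) * W)"
    using M W by (simp add: transpose_mult_dim mult_assoc_dim)
  also have "\<dots> = Z\<^sup>T * (mat_diag m l * Z)"
    unfolding eq Z_def using U W by (simp add: transpose_mult_dim mult_assoc_dim mat_diag_def)
  also have "tr \<dots> = tr ((mat_diag m l * Z) * Z\<^sup>T)"
    using Z by (intro tr_mult_commute[of _ k m]) (auto simp: mat_diag_def)
  also have "(mat_diag m l * Z) * Z\<^sup>T = mat_diag m l * (Z * Z\<^sup>T)"
    using Z by (simp add: mult_assoc_dim mat_diag_def)
  also have "tr \<dots> = (\<Sum>i<m. l i * (Z * Z\<^sup>T) $$ (i, i))"
    using Z by (simp add: tr_def mat_diag_mult_left[of _ m m] del: index_mult_mat(1))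
  finally show ?thesis by (simp add: Z_def)
qed

section \<open>Column spans, rank and orthonormal bases of column spaces\<close>

lemma (in vec_space) mem_span_colsE:
  assumes A: "A \<in> carrier_mat n k" and v: "v \<in> span (set (cols A))"
  obtains c where "c \<in> carrier_vec k" "v = A *\<^sub>v c"
proof -
  have cols: "set (cols A) \<subseteq> carrier_vec n" using A cols_dim by blast
  have "v \<in> span_list (cols A)"
    using v span_list_as_span[OF cols] by simp
  then obtain f where "v = lincomb_list f (cols A)"
    by (auto simp: span_list_def)
  also have "\<dots> = mat_of_cols n (cols A) *\<^sub>v vec (length (cols A)) f"
    using cols by (intro lincomb_list_as_mat_mult) auto
  also have "mat_of_cols n (cols A) = A" using A mat_of_cols_cols[of A] by simp
  finally show thesis using A that[of "vec k f"] by simp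
qed

lemma (in vec_space) mult_mat_vec_in_span_cols:
  assumes A: "A \<in> carrier_mat n k" and c: "c \<in> carrier_vec k"
  shows "A *\<^sub>v c \<in> span (set (cols A))"
proof -
  have cols: "set (cols A) \<subseteq> carrier_vec n" using A cols_dim by blast
  have "lincomb_list (($) c) (cols A) = mat_of_cols n (cols A) *\<^sub>v vec (length (cols A)) (($) c)"
    using cols by (intro lincomb_list_as_mat_mult) auto
  also have "mat_of_cols n (cols A) = A" using A mat_of_cols_cols[of A] by simp
  also have "vec (length (cols A)) (($) c) = c" using A c by auto
  finally have "A *\<^sub>v c \<in> span_list (cols A)"
    by (intro in_span_listI[where c = "($) c"]) auto
  thus ?thesis using span_list_as_span[OF cols] by simp
qed

text \<open>Each column of \<open>A * B\<close> is \<open>A\<close> applied to a column of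
  \<open>B\<close>, so the column space lies in that of \<open>A\<close>, which has only
  \<open>k\<close> columns.\<close>

lemma (in vec_space) rank_mult_le:
  assumes A: "A \<in> carrier_mat n k" and B: "B \<in> carrier_mat k nc"
  shows "rank (A * B) \<le> k"
proof -
  have cA: "set (cols A) \<subseteq> carrier_vec n" and cAB: "set (cols (A * B)) \<subseteq> carrier_vec n"
    using A B cols_dim[of A] cols_dim[of "A * B"] by auto
  have "set (cols (A * B)) \<subseteq> span (set (cols A))"
  proof
    fix x assume "x \<in> set (cols (A * B))"
    then obtain j where "j < nc" "x = col (A * B) j"
      using B by (auto simp: in_set_conv_nth)
    hence "x = A *\<^sub>v col B j" using A B by (simp del: col_mult)
    thus "x \<in> span (set (cols A))"
      using mult_mat_vec_in_span_cols[OF A] B col_dim[of B j] by auto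
  qed
  hence "span (set (cols (A * B))) \<subseteq> span (set (cols A))"
    using cA by (intro span_subsetI)
  hence sub: "subspace class_ring (span (set (cols (A * B)))) (vs (span (set (cols A))))"
    using cA cAB by (intro nested_subspaces span_is_subspace) auto
  have "vectorspace class_ring (vs (span (set (cols A))))"
    using cA by (intro subspace_is_vs span_is_subspace) auto
  from vectorspace.subspace_dim[OF this sub] have "rank (A * B) \<le> rank A"
    using fin_dim_span_cols[OF A] fin_dim_span_cols[of "A * B" nc] A B unfolding rank_def by simp
  thus ?thesis using rank_le_nc[OF A] by simp
qed

text \<open>\<open>us\<close> enumerates a maximal independent set of columns: a column outside its
  span could be adjoined. It is a list because Gram-Schmidt will be run on it.\<close>

lemma (in vec_space) independent_columns_spanning:
  assumes X: "X \<in> carrier_mat n nc"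
  obtains us where "distinct us" "set us \<subseteq> carrier_vec n" "lin_indpt (set us)"
    "length us = rank X" "set (cols X) \<subseteq> span (set us)"
proof -
  have cols: "set (cols X) \<subseteq> carrier_vec n" using X cols_dim by blast
  have "lin_indpt {}" using finite_lin_indpt2[of "{}"] by simp
  hence "\<exists>S. finite S \<and> maximal S (\<lambda>T. T \<subseteq> set (cols X) \<and> lin_indpt T) \<and> {} \<subseteq> S"
    by (intro maximal_exists_superset[of "set (cols X)"]) auto
  then obtain S where fin: "finite S" and max: "maximal S (\<lambda>T. T \<subseteq> set (cols X) \<and> lin_indpt T)"
    by auto
  have S: "S \<subseteq> set (cols X)" "lin_indpt S" using max by (auto simp: maximal_def)
  have "set (cols X) \<subseteq> span S"
  proof
    fix x assume x: "x \<in> set (cols X)"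
    show "x \<in> span S"
    proof (rule ccontr)
      assume nx: "x \<notin> span S"
      hence "x \<notin> S" using S cols in_own_span[of S] by auto
      moreover have "lin_indpt (insert x S)"
        using nx S x cols lin_dep_iff_in_span[of S x] \<open>x \<notin> S\<close> by auto
      ultimately show False using max S x unfolding maximal_def by blast
    qed
  qed
  moreover obtain us where us: "set us = S" "distinct us"
    using finite_distinct_list[OF fin] by auto
  moreover have "length us = rank X"
    using rank_card_indpt[OF X max] us distinct_card by fastforce
  ultimately show thesis using that[of us] S cols by auto
qed

text \<open>\<open>W\<close> is an orthonormal basis of the column space of \<open>X\<close>,
  obtained by Gram-Schmidt and normalization; the projection onto that space therefore fixes
  \<open>X\<close>.\<close>

lemma orthonormal_factor:
  fixes X :: "real mat"
  assumes X: "X \<in> carrier_mat m n"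
  obtains W where "W \<in> carrier_mat m (vec_space.rank m X)"
    "W\<^sup>T * W = 1\<^sub>m (vec_space.rank m X)" "W * (W\<^sup>T * X) = X"
proof -
  interpret V: vec_space "TYPE(real)" m .
  obtain us where us: "distinct us" "set us \<subseteq> carrier_vec m" "V.lin_indpt (set us)"
    "length us = V.rank X" "set (cols X) \<subseteq> V.span (set us)"
    by (rule V.independent_columns_spanning[OF X])
  define k where "k = V.rank X"
  interpret G: cof_vec_space m "TYPE(real)" .
  define ws where "ws = gram_schmidt m us"
  note gs = G.gram_schmidt_result[OF us(2,1,3) ws_def]
  define W' where "W' = mat_of_cols m ws"
  \<comment> \<open>Gram-Schmidt yields orthogonal but not normalized vectors. Their squared lengths
    \<open>s\<close> are positive, so scaling by \<open>d\<close> below normalizes them.\<close>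
  define s where "s i = ws ! i \<bullet> ws ! i" for i
  have len: "length ws = k" and cW': "cols W' = ws"
    using gs us by (simp_all add: W'_def k_def)
  have W': "W' \<in> carrier_mat m k"
    using mat_of_cols_carrier(1)[of m ws] by (simp add: W'_def len)
  have wsc: "ws ! i \<in> carrier_vec m" if "i < k" for i
    using that gs(3) len by (metis nth_mem subsetD)
  have ortho: "ws ! i \<bullet> ws ! j = (if i = j then s i else 0)" and s: "s i > 0" if "i < k" "j < k" for i j
  proof -
    have "(ws ! i \<bullet> ws ! j = 0) = (i \<noteq> j)" "s i \<noteq> 0"
      using corthogonalD[OF gs(2), of i j] corthogonalD[OF gs(2), of i i] that len by (auto simp: s_def)
    moreover have "s i \<ge> 0" by (auto simp: s_def scalar_prod_def intro!: sum_nonneg)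
    ultimately show "ws ! i \<bullet> ws ! j = (if i = j then s i else 0)" "s i > 0" by (auto simp: s_def)
  qed
  have "W'\<^sup>T * W' = mat_diag k s"
    using wsc len by (intro eq_matI) (auto simp: W'_def ortho mat_diag_def)
  define d where "d i = 1 / sqrt (s i)" for i
  define W where "W = W' * mat_diag k d"
  have W: "W \<in> carrier_mat m k" using W' by (simp add: W_def)
  have "W\<^sup>T * W = mat_diag k d * (W'\<^sup>T * W') * mat_diag k d"
  proof -
    have "(mat_diag k d)\<^sup>T = mat_diag k d" by (rule eq_matI) (auto simp: mat_diag_def)
    thus ?thesis using W' by (simp add: W_def transpose_mult_dim mult_assoc_dim mat_diag_def)
  qed
  also have "\<dots> = mat_diag k (\<lambda>i. d i * s i * d i)"
    by (simp add: \<open>W'\<^sup>T * W' = mat_diag k s\<close>)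
  also have "\<dots> = 1\<^sub>m k"
  proof (rule eq_matI)
    fix i j assume "i < dim_row (1\<^sub>m k :: real mat)" "j < dim_col (1\<^sub>m k :: real mat)"
    thus "mat_diag k (\<lambda>i. d i * s i * d i) $$ (i, j) = 1\<^sub>m k $$ (i, j)"
      using s[of j j] by (auto simp: mat_diag_def d_def field_simps)
  qed (auto simp: mat_diag_def)
  finally have WW: "W\<^sup>T * W = 1\<^sub>m k" .
  have "\<exists>c. c \<in> carrier_vec k \<and> col X j = W' *\<^sub>v c" if "j < n" for j
  proof -
    have "col X j \<in> V.span (set (cols W'))"
      using that us(5) X gs(1) cW' by (metis carrier_matD(2) cols_length cols_nth nth_mem subsetD)
    thus ?thesis by (metis V.mem_span_colsE[OF W'])
  qed
  then obtain c where c: "\<And>j. j < n \<Longrightarrow> c j \<in> carrier_vec k \<and> col X j = W' *\<^sub>v c j" by metis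
  define C where "C = mat k n (\<lambda>(i, j). c j $ i)"
  have C: "C \<in> carrier_mat k n" by (simp add: C_def)
  have "col C j = c j" if "j < n" for j
    using that c[OF that] by (auto simp: C_def)
  hence XC: "X = W' * C"
    using X W' C c by (intro mat_col_eqI) (simp_all del: col_mult)
  \<comment> \<open>Undoing the scaling turns \<open>X = W' * C\<close> into
    \<open>X = W * E\<close>, on which \<open>W * W\<^sup>T\<close> acts as the identity.\<close>
  have "W' = W * mat_diag k (\<lambda>i. sqrt (s i))"
  proof -
    have "mat_diag k (\<lambda>i. d i * sqrt (s i)) = 1\<^sub>m k"
    proof (rule eq_matI)
      fix i j assume "i < dim_row (1\<^sub>m k :: real mat)" "j < dim_col (1\<^sub>m k :: real mat)"
      thus "mat_diag k (\<lambda>i. d i * sqrt (s i)) $$ (i, j) = 1\<^sub>m k $$ (i, j)"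
        using s[of j j] by (auto simp: mat_diag_def d_def)
    qed (auto simp: mat_diag_def)
    hence "mat_diag k d * mat_diag k (\<lambda>i. sqrt (s i)) = 1\<^sub>m k" by simp
    thus ?thesis using W' by (simp add: W_def assoc_mult_mat[of _ m k _ k _ k])
  qed
  moreover define E where "E = mat_diag k (\<lambda>i. sqrt (s i)) * C"
  ultimately have E: "E \<in> carrier_mat k n" "X = W * E"
    using mult_carrier_mat[OF mat_diag_dim C] assoc_mult_mat[OF W mat_diag_dim C] XC by simp_all
  have "W * (W\<^sup>T * X) = W * (W\<^sup>T * W * E)"
    using E W by (simp add: mult_assoc_dim)
  also have "\<dots> = X" using E W by (simp add: WW)
  finally show thesis using that[of W] W WW by (simp add: k_def)
qed

section \<open>Eckart-Young theorem\<close>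

text \<open>The function \<open>l\<close> lists the eigenvalues of \<open>M * M\<^sup>T\<close>, that is the squared singular values of \<open>M\<close>.\<close>

locale left_svd =
  fixes M U :: "real mat" and l :: "nat \<Rightarrow> real" and m n :: nat
  assumes M: "M \<in> carrier_mat m n" and U: "U \<in> carrier_mat m m" and UU: "U\<^sup>T * U = 1\<^sub>m m"
    and gram: "M * M\<^sup>T = U * mat_diag m l * U\<^sup>T"
    and mono: "\<And>i j. i \<le> j \<Longrightarrow> j < m \<Longrightarrow> l j \<le> l i"
begin

lemma UUT: "U * U\<^sup>T = 1\<^sub>m m"
  using U UU by (intro mat_mult_left_right_inverse[of "U\<^sup>T" m U]) auto

text \<open>\<open>l i\<close> is the squared norm of row \<open>i\<close> of
  \<open>U\<^sup>T * M\<close>.\<close>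

lemma l_nonneg: "i < m \<Longrightarrow> 0 \<le> l i"
proof -
  assume i: "i < m"
  define N where "N = U\<^sup>T * M"
  have N: "N \<in> carrier_mat m n" using U M by (simp add: N_def)
  have "N * N\<^sup>T = U\<^sup>T * (M * M\<^sup>T) * U"
    using U M by (simp add: N_def transpose_mult_dim mult_assoc_dim)
  also have "\<dots> = (U\<^sup>T * U) * mat_diag m l * (U\<^sup>T * U)"
    unfolding gram using U by (simp add: mult_assoc_dim mat_diag_def)
  also have "\<dots> = mat_diag m l"
    by (simp add: UU left_mult_one_mat[OF mat_diag_dim] right_mult_one_mat[OF mat_diag_dim])
  finally have "l i = (N * N\<^sup>T) $$ (i, i)" using i by (simp add: mat_diag_def)
  also have "\<dots> = (\<Sum>j<n. N $$ (i, j) * N $$ (i, j))"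
    using N i by (simp add: scalar_prod_def atLeast0LessThan)
  finally show "0 \<le> l i" by (simp add: sum_nonneg)
qed

text \<open>The weight formula with the identity for \<open>W\<close>: the weights are the diagonal
  entries of \<open>U\<^sup>T * U\<close>, all equal to 1.\<close>

lemma frob_norm_sq: "(frob_norm M)\<^sup>2 = (\<Sum>i<m. l i)"
  using frob_norm_sq_transpose_mult[OF M one_carrier_mat U gram] M U UU
  by simp

text \<open>Ky Fan's maximum principle. Rotation by \<open>U\<close> keeps the columns orthonormal,
  so the weights lie in [0, 1] and sum to the trace of \<open>Z\<^sup>T * Z\<close>, which is
  \<open>k\<close>.\<close>

lemma frob_norm_sq_le:
  assumes W: "W \<in> carrier_mat m k" "W\<^sup>T * W = 1\<^sub>m k" and k: "k \<le> r"
  shows "(frob_norm (W\<^sup>T * M))\<^sup>2 \<le> (\<Sum>i<min r m. l i)"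
proof -
  define Z where "Z = U\<^sup>T * W"
  have Z: "Z \<in> carrier_mat m k" using U W by (simp add: Z_def)
  have "Z\<^sup>T * Z = W\<^sup>T * (U * U\<^sup>T) * W"
    using U W(1) by (simp add: Z_def transpose_mult_dim mult_assoc_dim)
  hence ZZ: "Z\<^sup>T * Z = 1\<^sub>m k" using W by (simp add: UUT)
  have "(\<Sum>i<m. (Z * Z\<^sup>T) $$ (i, i)) = tr (Z * Z\<^sup>T)" using Z by (simp add: tr_def)
  also have "\<dots> = real k"
    using tr_mult_commute[of Z m k "Z\<^sup>T"] Z by (simp add: ZZ)
  finally have "(\<Sum>i<m. (Z * Z\<^sup>T) $$ (i, i)) \<le> real r" using k by simp
  with mono l_nonneg diag_proj_le_one[OF Z ZZ] show ?thesis
    unfolding frob_norm_sq_transpose_mult[OF M W(1) U gram] Z_def[symmetric]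
    by (intro sum_weighted_le_sum_leading) auto
qed

text \<open>Projecting onto the column space of \<open>X\<close> fixes \<open>X\<close>, so
  \<open>M - X\<close> and \<open>M\<close> leave the same residual. Its norm is at most that of
  \<open>M - X\<close>, and Pythagoras for \<open>M\<close> combined with Ky Fan's bound estimates
  it from below.\<close>

lemma frob_norm_sq_minus_ge:
  assumes X: "X \<in> carrier_mat m n" "vec_space.rank m X \<le> r"
  shows "(\<Sum>i<m. l i) - (\<Sum>i<min r m. l i) \<le> (frob_norm (M - X))\<^sup>2"
proof -
  obtain W where W: "W \<in> carrier_mat m (vec_space.rank m X)"
    "W\<^sup>T * W = 1\<^sub>m (vec_space.rank m X)" and WX: "W * (W\<^sup>T * X) = X"
    by (rule orthonormal_factor[OF X(1)])
  define D where "D = M - X"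
  have D: "D \<in> carrier_mat m n" using X M by (auto simp: D_def)
  have "W * (W\<^sup>T * D) = W * (W\<^sup>T * M) - X"
  proof -
    have "W\<^sup>T * D = W\<^sup>T * M - W\<^sup>T * X"
      unfolding D_def using W(1) M X by (intro mult_minus_distrib_mat) auto
    hence "W * (W\<^sup>T * D) = W * (W\<^sup>T * M - W\<^sup>T * X)" by simp
    also have "\<dots> = W * (W\<^sup>T * M) - W * (W\<^sup>T * X)"
      using W(1) M X by (intro mult_minus_distrib_mat[of _ m _ _ n]) auto
    finally show ?thesis by (simp add: WX)
  qed
  hence "D - W * (W\<^sup>T * D) = M - W * (W\<^sup>T * M)"
    using W(1) M X by (intro eq_matI) (auto simp: D_def simp del: index_mult_mat(1))
  hence "(frob_norm D)\<^sup>2 - (frob_norm (W\<^sup>T * D))\<^sup>2 = (frob_norm M)\<^sup>2 - (frob_norm (W\<^sup>T * M))\<^sup>2"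
    using frob_norm_sq_minus_proj[OF W D] frob_norm_sq_minus_proj[OF W M] by simp
  moreover have "0 \<le> (frob_norm (W\<^sup>T * D))\<^sup>2" by simp
  ultimately show ?thesis
    using frob_norm_sq_le[OF W X(2)] unfolding D_def frob_norm_sq by linarith
qed

text \<open>The truncated singular value decomposition: \<open>J\<close> selects the first
  \<open>min r m\<close> columns of \<open>U\<close>, and \<open>M\<close> is projected onto them.
  The weights become 1 on the leading indices and 0 elsewhere.\<close>

lemma frob_norm_sq_minus_eq:
  obtains X where "X \<in> carrier_mat m n" "vec_space.rank m X \<le> r"
    "(frob_norm (M - X))\<^sup>2 = (\<Sum>i<m. l i) - (\<Sum>i<min r m. l i)"
proof -
  define p where "p = min r m"
  define J where "J = mat m p (\<lambda>(i, j). if i = j then 1 else 0 :: real)"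
  define W where "W = U * J"
  have J: "J \<in> carrier_mat m p" by (simp add: J_def)
  have W: "W \<in> carrier_mat m p" using U J by (simp add: W_def)
  have JJ: "J\<^sup>T * J = 1\<^sub>m p"
    by (rule eq_matI)
      (auto simp: J_def p_def scalar_prod_def if_distrib[of "\<lambda>x. x * _"] sum.delta cong: if_cong)
  have UW: "U\<^sup>T * W = J"
    using U J by (simp add: W_def mult_assoc_dim[symmetric] UU)
  have "W\<^sup>T * W = J\<^sup>T * (U\<^sup>T * W)"
    using U J W by (simp add: W_def transpose_mult_dim mult_assoc_dim)
  hence WW: "W\<^sup>T * W = 1\<^sub>m p" by (simp add: UW JJ)
  have JJT: "(J * J\<^sup>T) $$ (i, i) = (if i < p then 1 else 0)" if "i < m" for i
    using that by (auto simp: J_def scalar_prod_def if_distrib[of "\<lambda>x. x * _"] sum.delta cong: if_cong)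
  have "(frob_norm (W\<^sup>T * M))\<^sup>2 = (\<Sum>i<m. l i * (J * J\<^sup>T) $$ (i, i))"
    unfolding frob_norm_sq_transpose_mult[OF M W U gram] UW ..
  also have "\<dots> = (\<Sum>i<m. if i < p then l i else 0)"
    using JJT by (intro sum.cong) auto
  also have "\<dots> = (\<Sum>i<p. l i)"
    by (intro sum.mono_neutral_cong_right) (auto simp: p_def)
  finally have "(frob_norm (M - W * (W\<^sup>T * M)))\<^sup>2 = (\<Sum>i<m. l i) - (\<Sum>i<p. l i)"
    using frob_norm_sq_minus_proj[OF W WW M] by (simp add: frob_norm_sq)
  moreover have "vec_space.rank m (W * (W\<^sup>T * M)) \<le> r"
    using vec_space.rank_mult_le[OF W, of "W\<^sup>T * M" n] W M by (simp add: p_def)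
  ultimately show thesis
    using that[of "W * (W\<^sup>T * M)"] W M by (simp add: p_def)
qed

end

subsection \<open>Block updates\<close>

text \<open>The lower blocks have no rows; this form opens concatenations to the block
  multiplication rule.\<close>

lemma hcat_eq_four_block:
  assumes "P \<in> carrier_mat m p" "R \<in> carrier_mat m q"
  shows "hcat P R = four_block_mat P R (0\<^sub>m 0 p) (0\<^sub>m 0 q)"
  using assms by (intro eq_matI) (auto simp: hcat_def mat_of_cols_index nth_append)

lemma hcat_carrier:
  "P \<in> carrier_mat m p \<Longrightarrow> R \<in> carrier_mat m q \<Longrightarrow> hcat P R \<in> carrier_mat m (p + q)"
  by (auto simp: hcat_def)

lemma transpose_hcat:
  fixes P R :: "'a :: zero mat"
  assumes "P \<in> carrier_mat m p" "R \<in> carrier_mat m q"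
  shows "(hcat P R)\<^sup>T = four_block_mat P\<^sup>T (0\<^sub>m p 0) R\<^sup>T (0\<^sub>m q 0)"
  unfolding hcat_eq_four_block[OF assms]
  using assms by (subst transpose_four_block_mat[of _ m p _ q _ 0]) auto

lemma four_block_mat_empty:
  assumes "X \<in> carrier_mat m n"
  shows "four_block_mat X (0\<^sub>m m 0) (0\<^sub>m 0 n) (0\<^sub>m 0 0) = X"
  using assms by (intro eq_matI) auto

lemma hcat_mult_four_block_transpose:
  fixes P R :: "'a :: comm_semiring_1 mat"
  assumes P: "P \<in> carrier_mat m p" and R: "R \<in> carrier_mat m q"
    and S: "A \<in> carrier_mat p p" "B \<in> carrier_mat p q" "C \<in> carrier_mat q p" "D \<in> carrier_mat q q"
  shows "hcat P R * four_block_mat A B C D * (hcat P R)\<^sup>T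
    = (P * A + R * C) * P\<^sup>T + (P * B + R * D) * R\<^sup>T"
proof -
  have "hcat P R * four_block_mat A B C D
      = four_block_mat (P * A + R * C) (P * B + R * D) (0\<^sub>m 0 p) (0\<^sub>m 0 q)"
    unfolding hcat_eq_four_block[OF P R] using P R S
    by (subst mult_four_block_mat[where ?nr1.0 = m and ?nr2.0 = 0 and ?n1.0 = p and ?n2.0 = q and ?nc1.0 = p and ?nc2.0 = q])
      (auto intro!: cong_four_block_mat eq_matI)
  also have "\<dots> * (hcat P R)\<^sup>T =
      four_block_mat ((P * A + R * C) * P\<^sup>T + (P * B + R * D) * R\<^sup>T) (0\<^sub>m m 0) (0\<^sub>m 0 m) (0\<^sub>m 0 0)"
    unfolding transpose_hcat[OF P R] using P R S
    by (subst mult_four_block_mat[where ?nr1.0 = m and ?nr2.0 = 0 and ?n1.0 = p and ?n2.0 = q and ?nc1.0 = m and ?nc2.0 = 0])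
      (auto intro!: cong_four_block_mat eq_matI)
  also have "\<dots> = (P * A + R * C) * P\<^sup>T + (P * B + R * D) * R\<^sup>T"
    using P R S by (intro four_block_mat_empty) (auto intro!: add_carrier_mat mult_carrier_mat[of _ m q _ m])
  finally show ?thesis .
qed

lemma hcat_mult_transpose:
  fixes P R :: "'a :: comm_semiring_1 mat"
  assumes P: "P \<in> carrier_mat m p" and R: "R \<in> carrier_mat m q"
  shows "hcat P R * (hcat P R)\<^sup>T = P * P\<^sup>T + R * R\<^sup>T"
  using hcat_mult_four_block_transpose[OF P R one_carrier_mat zero_carrier_mat zero_carrier_mat one_carrier_mat]
    P R hcat_carrier[OF P R] by (simp add: left_add_zero_mat[of _ m q] right_add_zero_mat[of _ m p])

lemma transpose_hcat_mult:
  fixes P R :: "'a :: comm_semiring_1 mat"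
  assumes P: "P \<in> carrier_mat m p" and R: "R \<in> carrier_mat m q"
  shows "(hcat P R)\<^sup>T * hcat P R = four_block_mat (P\<^sup>T * P) (P\<^sup>T * R) (R\<^sup>T * P) (R\<^sup>T * R)"
  unfolding transpose_hcat[OF P R] unfolding hcat_eq_four_block[OF P R] using P R
  by (subst mult_four_block_mat[where ?nr1.0 = p and ?nr2.0 = q and ?n1.0 = m and ?n2.0 = 0 and ?nc1.0 = p and ?nc2.0 = q])
    (auto intro!: cong_four_block_mat eq_matI)

lemma block_row_Suc:
  assumes "\<And>i. i \<in> {1..t} \<Longrightarrow> A i \<in> carrier_mat m (n i)"
  shows "block_row m A (Suc t) = hcat (block_row m A t) (A (Suc t))"
proof -
  \<comment> \<open>\<open>cols\<close> recovers the list given to \<open>mat_of_cols\<close> when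
    all its vectors have dimension \<open>m\<close>.\<close>
  have "set (cols (A i)) \<subseteq> carrier_vec m" if "i \<in> {1..t}" for i
    using assms[OF that] cols_dim by blast
  hence "set (concat (map (\<lambda>i. cols (A i)) [1..<Suc t])) \<subseteq> carrier_vec m"
    by fastforce
  thus ?thesis by (simp add: block_row_def hcat_def)
qed

lemma block_row_carrier:
  assumes "\<And>i. i \<in> {1..t} \<Longrightarrow> A i \<in> carrier_mat m (n i)"
  shows "block_row m A t \<in> carrier_mat m (\<Sum>i = 1..t. n i)"
  using assms
proof (induction t)
  case (Suc t)
  have "block_row m A (Suc t) = hcat (block_row m A t) (A (Suc t))"
    using Suc.prems by (intro block_row_Suc[of t A m n]) auto
  thus ?case
    using Suc hcat_carrier[of "block_row m A t" m "\<Sum>i = 1..t. n i" "A (Suc t)" "n (Suc t)"]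
    by simp
qed (use mat_of_cols_carrier(1)[of m "[]"] in \<open>simp add: block_row_def\<close>)

lemma frob_norm_sq_hcat:
  assumes P: "P \<in> carrier_mat m p" and R: "R \<in> carrier_mat m q"
  shows "(frob_norm (hcat P R))\<^sup>2 = (frob_norm P)\<^sup>2 + (frob_norm R)\<^sup>2"
proof -
  \<comment> \<open>\<open>X * X\<^sup>T\<close> is used because it is additive under
    concatenation.\<close>
  have fr: "(frob_norm X)\<^sup>2 = tr (X * X\<^sup>T)" for X
    unfolding frob_norm_sq_eq_tr by (rule tr_mult_commute) auto
  show ?thesis
    using P R unfolding fr hcat_mult_transpose[OF P R]
    by (simp add: tr_def sum.distrib)
qed

lemma frob_norm_sq_block_row:
  assumes "\<And>i. i \<in> {1..t} \<Longrightarrow> A i \<in> carrier_mat m (n i)"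
  shows "(frob_norm (block_row m A t))\<^sup>2 = (\<Sum>i = 1..t. (frob_norm (A i))\<^sup>2)"
  using assms
proof (induction t)
  case (Suc t)
  have "block_row m A t \<in> carrier_mat m (\<Sum>i = 1..t. n i)"
    using Suc.prems by (intro block_row_carrier) auto
  moreover have "block_row m A (Suc t) = hcat (block_row m A t) (A (Suc t))"
    using Suc.prems by (intro block_row_Suc[of t A m n]) auto
  ultimately show ?case
    using Suc by (simp add: frob_norm_sq_hcat[of _ m _ _ "n (Suc t)"])
qed (simp add: block_row_def frob_norm_def)

section \<open>Invariants of a single update and of a whole run\<close>

text \<open>The only use of the hypothesis that the columns of \<open>Q\<close> lie in the column space of \<open>R\<close>:
  it makes the new columns orthogonal to the old ones.\<close>

lemma thin_qr_annihilate:
  assumes qr: "thin_qr R Q B" and R: "R \<in> carrier_mat m n" and P: "P \<in> carrier_mat p m"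
    and PR: "P * R = 0\<^sub>m p n"
  shows "P * Q = 0\<^sub>m p (dim_col Q)"
proof -
  interpret V: vec_space "TYPE(real)" m .
  have Q: "Q \<in> carrier_mat m (dim_col Q)" and bas: "V.is_col_space_basis R (set (cols Q))"
    using qr R by (auto simp: thin_qr_def)
  have cols: "set (cols R) \<subseteq> carrier_vec m" using R cols_dim by blast
  have "vectorspace class_ring (V.vs (V.span (set (cols R))))"
    using cols by (intro V.subspace_is_vs V.span_is_subspace) auto
  hence sub: "set (cols Q) \<subseteq> V.span (set (cols R))"
    using bas unfolding V.is_col_space_basis_def by (auto simp: vectorspace.basis_def)
  show ?thesis
  proof (rule mat_col_eqI)
    fix j assume j: "j < dim_col (0\<^sub>m p (dim_col Q) :: real mat)"
    hence "col Q j \<in> V.span (set (cols R))"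
      using sub by (metis cols_length cols_nth index_zero_mat(3) nth_mem subsetD)
    then obtain c where c: "c \<in> carrier_vec n" "col Q j = R *\<^sub>v c"
      by (rule V.mem_span_colsE[OF R])
    have "col (P * Q) j = P *\<^sub>v (R *\<^sub>v c)"
      using col_mult2[OF P Q, of j] j c(2) by (simp del: col_mult)
    also have "\<dots> = (P * R) *\<^sub>v c"
      by (rule assoc_mult_mat_vec[OF P R c(1), symmetric])
    finally show "col (P * Q) j = col (0\<^sub>m p (dim_col Q)) j"
      using j c(1) by (intro eq_vecI) (simp_all add: PR)
  qed (use P in auto)
qed

text \<open>Let Z be \<open>Y\<close> stacked on \<open>B\<close>. Then \<open>S'\<close> is
  \<open>S\<close> padded with zeros plus Z times its transpose, and the extended basis maps Z to
  \<open>Q * Y + R = A\<close>; conjugation thus adds \<open>A * A\<^sup>T\<close>.\<close>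

lemma block_update_invariant:
  assumes Q: "Q \<in> carrier_mat m p" and S: "S \<in> carrier_mat p p" and QQ: "Q\<^sup>T * Q = 1\<^sub>m p"
    and A: "A \<in> carrier_mat m n" and upd: "block_update Q S A Q' S'"
  obtains p' where "Q' \<in> carrier_mat m p'" "S' \<in> carrier_mat p' p'" "Q'\<^sup>T * Q' = 1\<^sub>m p'"
    "Q' * S' * Q'\<^sup>T = Q * S * Q\<^sup>T + A * A\<^sup>T"
proof -
  define Y where "Y = Q\<^sup>T * A"
  define R where "R = A - Q * Y"
  obtain W B where qr: "thin_qr R W B" and Q': "Q' = hcat Q W"
    and S': "S' = four_block_mat (S + Y * Y\<^sup>T) (Y * B\<^sup>T) (B * Y\<^sup>T) (B * B\<^sup>T)"
    using upd unfolding block_update_def Let_def Y_def R_def by auto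
  have Y: "Y \<in> carrier_mat p n" using Q A by (simp add: Y_def)
  have QY: "Q * Y \<in> carrier_mat m n" using Q Y by simp
  have R: "R \<in> carrier_mat m n" using A QY unfolding R_def by (intro minus_carrier_mat)
  define q where "q = dim_col W"
  have W: "W \<in> carrier_mat m q" and B: "B \<in> carrier_mat q n" and WW: "W\<^sup>T * W = 1\<^sub>m q"
    and RWB: "R = W * B"
    using qr R by (auto simp: thin_qr_def q_def orthonormal_cols_def)
  \<comment> \<open>The residual is orthogonal to \<open>Q\<close> by construction; this passes to
    \<open>W\<close>, whose columns lie in the column space of \<open>R\<close>.\<close>
  have "Q\<^sup>T * R = Q\<^sup>T * A - Q\<^sup>T * (Q * Y)"
    unfolding R_def using Q A QY by (intro mult_minus_distrib_mat) auto
  also have "Q\<^sup>T * (Q * Y) = Y"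
    using Q Y QQ by (simp add: mult_assoc_dim[symmetric])
  finally have "Q\<^sup>T * R = 0\<^sub>m p n" using Y by (simp add: Y_def[symmetric])
  from thin_qr_annihilate[OF qr R _ this] Q have QW: "Q\<^sup>T * W = 0\<^sub>m p q" by (simp add: q_def)
  have WQ: "W\<^sup>T * Q = 0\<^sub>m q p"
    using arg_cong[OF QW, of transpose_mat] Q W by (simp add: transpose_mult_dim)
  have "Q'\<^sup>T * Q' = 1\<^sub>m (p + q)"
    unfolding Q' transpose_hcat_mult[OF Q W] by (simp add: QQ QW WQ WW)
  moreover have "Q' \<in> carrier_mat m (p + q)" unfolding Q' by (rule hcat_carrier[OF Q W])
  moreover have "S' \<in> carrier_mat (p + q) (p + q)"
    unfolding S' using S Y B by (intro four_block_carrier_mat) auto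
  moreover have "Q' * S' * Q'\<^sup>T = Q * S * Q\<^sup>T + A * A\<^sup>T"
  proof -
    \<comment> \<open>\<open>P\<close> is the part of \<open>A\<close> in the span of
      \<open>Q\<close>. The four products of \<open>A = P + R\<close> with its transpose match the
      four blocks of the update.\<close>
    define P where "P = Q * Y"
    have P: "P \<in> carrier_mat m n" using QY by (simp add: P_def)
    have "A = P + R" using A P unfolding R_def P_def[symmetric] by auto
    hence AA: "A * A\<^sup>T = (P + R) * (P\<^sup>T + R\<^sup>T)" using P R by (simp add: transpose_add)
    also have "\<dots> = P * (P\<^sup>T + R\<^sup>T) + R * (P\<^sup>T + R\<^sup>T)"
      using P R by (intro add_mult_distrib_mat) auto
    also have "P * (P\<^sup>T + R\<^sup>T) = P * P\<^sup>T + P * R\<^sup>T"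
      using P R by (intro mult_add_distrib_mat) auto
    also have "R * (P\<^sup>T + R\<^sup>T) = R * P\<^sup>T + R * R\<^sup>T"
      using P R by (intro mult_add_distrib_mat) auto
    finally have AA: "A * A\<^sup>T = (P * P\<^sup>T + P * R\<^sup>T) + (R * P\<^sup>T + R * R\<^sup>T)" .
    have "Q' * S' * Q'\<^sup>T = (Q * (S + Y * Y\<^sup>T) + W * (B * Y\<^sup>T)) * Q\<^sup>T
        + (Q * (Y * B\<^sup>T) + W * (B * B\<^sup>T)) * W\<^sup>T"
      unfolding Q' S' using Q W S Y B by (intro hcat_mult_four_block_transpose) auto
    also have "Q * (S + Y * Y\<^sup>T) = Q * S + Q * (Y * Y\<^sup>T)"
      using Q S Y by (intro mult_add_distrib_mat) auto
    also have "(Q * S + Q * (Y * Y\<^sup>T) + W * (B * Y\<^sup>T)) * Q\<^sup>T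
        = (Q * S + Q * (Y * Y\<^sup>T)) * Q\<^sup>T + W * (B * Y\<^sup>T) * Q\<^sup>T"
      using Q S Y W B by (intro add_mult_distrib_mat[of _ m p]) auto
    also have "(Q * S + Q * (Y * Y\<^sup>T)) * Q\<^sup>T = Q * S * Q\<^sup>T + Q * (Y * Y\<^sup>T) * Q\<^sup>T"
      using Q S Y by (intro add_mult_distrib_mat[of _ m p]) auto
    also have "(Q * (Y * B\<^sup>T) + W * (B * B\<^sup>T)) * W\<^sup>T = Q * (Y * B\<^sup>T) * W\<^sup>T + W * (B * B\<^sup>T) * W\<^sup>T"
      using Q Y W B by (intro add_mult_distrib_mat[of _ m q]) auto
    also have "Q * (Y * Y\<^sup>T) * Q\<^sup>T = P * P\<^sup>T"
      using Q Y by (simp add: P_def transpose_mult_dim mult_assoc_dim)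
    also have "W * (B * Y\<^sup>T) * Q\<^sup>T = R * P\<^sup>T"
      using Q Y W B by (simp add: P_def RWB transpose_mult_dim mult_assoc_dim)
    also have "Q * (Y * B\<^sup>T) * W\<^sup>T = P * R\<^sup>T"
      using Q Y W B by (simp add: P_def RWB transpose_mult_dim mult_assoc_dim)
    also have "W * (B * B\<^sup>T) * W\<^sup>T = R * R\<^sup>T"
      using W B by (simp add: RWB transpose_mult_dim mult_assoc_dim)
    finally have eq: "Q' * S' * Q'\<^sup>T = Q * S * Q\<^sup>T + P * P\<^sup>T + R * P\<^sup>T + (P * R\<^sup>T + R * R\<^sup>T)" .
    show ?thesis unfolding eq AA
      using Q S P R by (intro eq_matI) (auto simp del: index_mult_mat(1))
  qed
  ultimately show thesis using that by blast
qed

text \<open>The size \<open>p\<close> is existential because it depends on how many new directions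
  each block contributes.\<close>

lemma incr_state_untruncated:
  assumes A: "\<And>i. i \<in> {1..t} \<Longrightarrow> A i \<in> carrier_mat m (n i)"
    and "incr_state m None A t Q S"
  shows "\<exists>p. Q \<in> carrier_mat m p \<and> S \<in> carrier_mat p p \<and> Q\<^sup>T * Q = 1\<^sub>m p \<and>
    Q * S * Q\<^sup>T = block_row m A t * (block_row m A t)\<^sup>T"
  using assms(2,1)
proof (induction rule: incr_state.induct)
  case init
  \<comment> \<open>Before any block both sides are zero matrices, being sums over an empty index
    set.\<close>
  show ?case by (intro exI[of _ 0]) (auto simp: block_row_def scalar_prod_def intro!: eq_matI)
next
  case (step t Q S Q1 S1 Q' S')
  then obtain p where Q: "Q \<in> carrier_mat m p" and S: "S \<in> carrier_mat p p" and QQ: "Q\<^sup>T * Q = 1\<^sub>m p"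
    and eq: "Q * S * Q\<^sup>T = block_row m A t * (block_row m A t)\<^sup>T"
    by (metis atLeastAtMost_iff le_SucI)
  have At: "A (Suc t) \<in> carrier_mat m (n (Suc t))" using step.prems by simp
  obtain p' where "Q' \<in> carrier_mat m p'" "S' \<in> carrier_mat p' p'" "Q'\<^sup>T * Q' = 1\<^sub>m p'"
    "Q' * S' * Q'\<^sup>T = Q * S * Q\<^sup>T + A (Suc t) * (A (Suc t))\<^sup>T"
    using block_update_invariant[OF Q S QQ At] step.hyps(2,3) by auto
  moreover have "block_row m A t \<in> carrier_mat m (\<Sum>i = 1..t. n i)"
    using step.prems by (intro block_row_carrier) auto
  moreover have "block_row m A (Suc t) = hcat (block_row m A t) (A (Suc t))"
    using step.prems by (intro block_row_Suc[of t A m n]) auto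
  ultimately show ?case
    using eq hcat_mult_transpose[of "block_row m A t" m _ "A (Suc t)"] At by auto
qed

section \<open>Singular values of the block matrix and the error formula\<close>

text \<open>The descending eigenvalues serve as \<open>l\<close>, shifted by one because
  \<open>eigval\<close> counts from 1. Every root of the characteristic polynomial is among them, so
  \<open>l_nonneg\<close> covers the whole spectrum.\<close>

lemma left_svd_gram:
  assumes M: "M \<in> carrier_mat m n"
  obtains U l where "left_svd M U l m n"
    "\<forall>j\<ge>1. eigval (M * M\<^sup>T) j = (if j \<le> m then l (j - 1) else 0)"
    "\<forall>x \<in># proots (char_poly (M * M\<^sup>T)). 0 \<le> x"
proof -
  define G where "G = M * M\<^sup>T"
  have G: "G \<in> carrier_mat m m" "G\<^sup>T = G"
    using M by (simp_all add: G_def transpose_mult_dim)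
  define es where "es = eigvals_desc G"
  obtain U where U: "U \<in> carrier_mat m m" "U\<^sup>T * U = 1\<^sub>m m" "G = U * mat_diag m ((!) es) * U\<^sup>T"
    and len: "length es = m" and mset: "mset es = proots (char_poly G)"
    using real_symmetric_spectral[OF G] unfolding es_def by metis
  have "es ! j \<le> es ! i" if "i \<le> j" "j < m" for i j
    using that len sorted_rev_nth_mono[of es i j] by (simp add: es_def eigvals_desc_def)
  hence svd: "left_svd M U ((!) es) m n"
    using M U by unfold_locales (simp_all add: G_def)
  have "eigval G j = (if j \<le> m then es ! (j - 1) else 0)" if "1 \<le> j" for j
    using that len by (simp add: eigval_def es_def)
  moreover have "0 \<le> x" if "x \<in># proots (char_poly G)" for x
    using that left_svd.l_nonneg[OF svd] len by (metis mset set_mset_mset in_set_conv_nth)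
  ultimately show thesis using that[OF svd] by (simp add: G_def)
qed

text \<open>A minimizer is exhibited in the conclusion because \<open>best_rank_error\<close> is a
  \<open>LEAST\<close>, which is informative only when a least value exists.\<close>

theorem corollary2:
  fixes A :: "nat \<Rightarrow> real mat" and n :: "nat \<Rightarrow> nat" and m K :: nat and Q S :: "real mat"
  assumes K: "K \<ge> 1"
    and "\<And>i. i \<in> {1..K} \<Longrightarrow> A i \<in> carrier_mat m (n i)"
    and "incr_state m None A K Q S"
  shows "(frob_norm (block_row m A K))\<^sup>2 = (\<Sum>i = 1..K. (frob_norm (A i))\<^sup>2) \<and>
    (\<forall>j\<ge>1. approx_singval S j = singval (block_row m A K) j) \<and>
    (\<forall>r.
      (\<exists>X \<in> carrier_mat m (\<Sum>i = 1..K. n i). vec_space.rank m X \<le> r \<and>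
        frob_norm (block_row m A K - X) = best_rank_error r (block_row m A K) \<and>
        (\<forall>X' \<in> carrier_mat m (\<Sum>i = 1..K. n i). vec_space.rank m X' \<le> r \<longrightarrow>
          frob_norm (block_row m A K - X) \<le> frob_norm (block_row m A K - X'))) \<and>
      best_rank_error r (block_row m A K) =
        sqrt (\<Sum>k. (singval (block_row m A K) (r + 1 + k))\<^sup>2) \<and>
      plugin_error A K S r = best_rank_error r (block_row m A K))"
proof -
  define M where "M = block_row m A K"
  define N where "N = (\<Sum>i = 1..K. n i)"
  have M: "M \<in> carrier_mat m N"
    unfolding M_def N_def using assms(2) by (rule block_row_carrier)
  have frob: "(frob_norm M)\<^sup>2 = (\<Sum>i = 1..K. (frob_norm (A i))\<^sup>2)"
    unfolding M_def using assms(2) by (rule frob_norm_sq_block_row)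
  obtain p where Q: "Q \<in> carrier_mat m p" and S: "S \<in> carrier_mat p p" and QQ: "Q\<^sup>T * Q = 1\<^sub>m p"
    and QSQ: "Q * S * Q\<^sup>T = M * M\<^sup>T"
    using incr_state_untruncated[OF assms(2,3)] by (auto simp: M_def)
  obtain U l where svd: "left_svd M U l m N"
    and ev: "\<forall>j\<ge>1. eigval (M * M\<^sup>T) j = (if j \<le> m then l (j - 1) else 0)"
    and nonneg: "\<forall>x \<in># proots (char_poly (M * M\<^sup>T)). 0 \<le> x"
    by (rule left_svd_gram[OF M])
  interpret left_svd M U l m N by (rule svd)
  have MMT: "M * M\<^sup>T \<in> carrier_mat m m" and MTM: "M\<^sup>T * M \<in> carrier_mat N N"
    using M by simp_all
  have evS: "eigval S j = eigval (M * M\<^sup>T) j" if "1 \<le> j" for j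
  proof -
    \<comment> \<open>Swapping the factors \<open>Q\<close> and \<open>S * Q\<^sup>T\<close> leads
      from the Gram matrix to \<open>S\<close>, by orthonormality of \<open>Q\<close>.\<close>
    have "Q * (S * Q\<^sup>T) = M * M\<^sup>T" "S * Q\<^sup>T * Q = S"
      using Q S QQ QSQ by (simp_all add: mult_assoc_dim)
    hence "[:0, 1:] ^ p * char_poly (M * M\<^sup>T) = [:0, 1:] ^ m * char_poly S"
      using char_poly_mult_commute[of Q m p "S * Q\<^sup>T"] Q S by simp
    from eigval_eqI[OF this MMT S _ that] nonneg show ?thesis by simp
  qed
  have evM: "eigval (M\<^sup>T * M) j = eigval (M * M\<^sup>T) j" if "1 \<le> j" for j
  proof -
    have "[:0, 1:] ^ N * char_poly (M * M\<^sup>T) = [:0, 1:] ^ m * char_poly (M\<^sup>T * M)"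
      using M by (intro char_poly_mult_commute) auto
    from eigval_eqI[OF this MMT MTM _ that] nonneg show ?thesis by simp
  qed
  have approx: "approx_singval S j = singval M j" if "1 \<le> j" for j
    using that by (simp add: approx_singval_def singval_def evS evM)
  have sq: "(singval M j)\<^sup>2 = (if j \<le> m then l (j - 1) else 0)" if "1 \<le> j" for j
    using that l_nonneg by (simp add: singval_def evM ev)
  have rank: "(\<exists>X \<in> carrier_mat m N. vec_space.rank m X \<le> r \<and>
        frob_norm (M - X) = best_rank_error r M \<and>
        (\<forall>X' \<in> carrier_mat m N. vec_space.rank m X' \<le> r \<longrightarrow> frob_norm (M - X) \<le> frob_norm (M - X'))) \<and>
      best_rank_error r M = sqrt (\<Sum>k. (singval M (r + 1 + k))\<^sup>2) \<and>
      plugin_error A K S r = best_rank_error r M" for r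
  proof -
    define e where "e = (\<Sum>i<m. l i) - (\<Sum>i<min r m. l i)"
    obtain X where X: "X \<in> carrier_mat m N" "vec_space.rank m X \<le> r" "(frob_norm (M - X))\<^sup>2 = e"
      unfolding e_def by (rule frob_norm_sq_minus_eq)
    have frX: "frob_norm (M - X) = sqrt e"
      using X(3) frob_norm_nonneg[of "M - X"] by (metis real_sqrt_unique)
    have le: "frob_norm (M - X) \<le> frob_norm (M - X')"
      if "X' \<in> carrier_mat m N" "vec_space.rank m X' \<le> r" for X'
      using frob_norm_sq_minus_ge[OF that] X(3) frob_norm_nonneg
      by (metis e_def power2_le_imp_le)
    \<comment> \<open>The lower bound is attained at \<open>X\<close>, which identifies the
      \<open>LEAST\<close>.\<close>
    have best: "best_rank_error r M = frob_norm (M - X)"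
      unfolding best_rank_error_def using X M le by (intro Least_equality) auto
    \<comment> \<open>Terms with \<open>r + 1 + k > m\<close> vanish. For \<open>r \<ge> m\<close>
      the truncated difference \<open>m - r\<close> is 0 and the sum is empty, in agreement with
      \<open>{min r m..<m}\<close>.\<close>
    have "(\<Sum>k. (singval M (r + 1 + k))\<^sup>2) = (\<Sum>k<m - r. (singval M (r + 1 + k))\<^sup>2)"
      by (intro suminf_finite) (auto simp: sq)
    also have "\<dots> = (\<Sum>k<m - r. l (r + k))"
      by (intro sum.cong) (auto simp: sq)
    also have "\<dots> = (\<Sum>i\<in>{min r m..<m}. l i)"
      by (intro sum.reindex_bij_witness[of _ "\<lambda>i. i - r" "\<lambda>k. r + k"]) auto
    also have "\<dots> = e"
      using sum.atLeastLessThan_concat[of 0 "min r m" m l] by (simp add: e_def atLeast0LessThan)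
    finally have tail: "(\<Sum>k. (singval M (r + 1 + k))\<^sup>2) = e" .
    have "(\<Sum>j = 1..r. (approx_singval S j)\<^sup>2) = (\<Sum>j = 1..r. if j \<le> m then l (j - 1) else 0)"
      by (intro sum.cong) (auto simp: approx sq)
    \<comment> \<open>Shift from one-based to zero-based indices: \<open>j \<le> m\<close> becomes
      \<open>i < m\<close>.\<close>
    also have "\<dots> = (\<Sum>i<r. if i < m then l i else 0)"
      by (intro sum.reindex_bij_witness[of _ Suc "\<lambda>j. j - 1"]) auto
    also have "\<dots> = (\<Sum>i<min r m. l i)"
      by (intro sum.mono_neutral_cong_right) auto
    finally have "plugin_error A K S r = sqrt e"
      using frob by (simp add: plugin_error_def frob_norm_sq e_def)
    thus ?thesis using X le best frX tail by auto
  qed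
  show ?thesis
    unfolding M_def[symmetric] N_def[symmetric] using frob approx rank by blast
qed

end
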